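(* Let $N=(N_t)_{t\in\mathbb{R}}$ be a measurable process with stationary increments, $N_0=0$ a.s., and finite second moments. Let $X$ be a QOU process driven by $N$ with parameter $\lambda>0$. (i) Assume that $\mathrm{V}_N$ is three times continuously differentiable in a neighborhood of $\infty$, and that for $t\to\infty$ we have $\mathrm{V}_N''(t)=O(e^{(\lambda/2)t})$, $e^{-\lambda t}=o(\mathrm{V}_N''(t))$ and $\mathrm{V}_N'''(t)=o(\mathrm{V}_N''(t))$. Then, for $t\to\infty$, $$\mathrm{R}_X(t)\sim\Big(\frac{1}{2\lambda^2}\Big)\mathrm{V}_N''(t).$$ (ii) Assume that $t^2=o(\mathrm{V}_N(t))$ for $t\to0$. Then, for $t\to0$, $\bar{\mathrm{R}}_X(t)\sim\frac12\mathrm{V}_N(t)$. More generally, let $p\ge1$ and assume that $N$ has finite $p$ moments and $t=o(\|N_t\|_p)$ as $t\to0$. Then, for $t\to0$, $\|X_t-X_0\|_p\sim\|N_t\|_p$.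
   Context: A process $Z=(Z_t)_{t\in\mathbb{R}}$ on $(\Omega,\mathcal{F},P)$ is measurable if $(t,\omega)\mapsto Z_t(\omega)$ is $\mathcal{B}(\mathbb{R})\otimes\mathcal{F}$-measurable. It has stationary increments if for all $s\in\mathbb{R}$, $(Z_t-Z_0)_{t\in\mathbb{R}}$ has the same finite-dimensional distributions as $(Z_{t+s}-Z_s)_{t\in\mathbb{R}}$. It has finite $p$ moments if $E[|Z_t|^p]<\infty$ for all $t$. $\|Y\|_p=E[|Y|^p]^{1/p}$. A QOU process driven by $N$ with parameter $\lambda>0$ is a stationary process $X=(X_t)_{t\in\mathbb{R}}$ satisfying $X_t=X_0-\lambda\int_0^tX_s\,ds+N_t$ for all $t\in\mathbb{R}$, where the integral is a pathwise Lebesgue integral (with $\int_0^t=-\int_t^0$ for $t<0$). For a process $Z$ with finite second moments, $\mathrm{V}_Z(t)=\operatorname{Var}(Z_t)$; if $Z$ is also stationary, $\mathrm{R}_Z(t)=\operatorname{Cov}(Z_t,Z_0)$ is its autocovariance function and $\bar{\mathrm{R}}_Z(t)=\mathrm{R}_Z(0)-\mathrm{R}_Z(t)=\frac12E[(Z_t-Z_0)^2]$. For $t\to0$ or $t\to\infty$, $f(t)\sim g(t)$, $f(t)=o(g(t))$, $f(t)=O(g(t))$ mean $f(t)/g(t)\to1$, $f(t)/g(t)\to0$, $\limsup_t|f(t)/g(t)|<\infty$, respectively. *)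

theory Defs
  imports "HOL-Probability.Probability" "HOL-Library.Landau_Symbols"
begin

text \<open>A process on a probability space \<open>M\<close> is a function \<open>Z :: real \<Rightarrow> 'a \<Rightarrow> real\<close>,
  with \<open>Z t\<close> the value at time \<open>t\<close>.\<close>

definition measurable_process :: "'a measure \<Rightarrow> (real \<Rightarrow> 'a \<Rightarrow> real) \<Rightarrow> bool" where
  "measurable_process M Z \<longleftrightarrow> (\<lambda>(t, \<omega>). Z t \<omega>) \<in> borel_measurable (borel \<Otimes>\<^sub>M M)"

definition same_fdd :: "'a measure \<Rightarrow> (real \<Rightarrow> 'a \<Rightarrow> real) \<Rightarrow> (real \<Rightarrow> 'a \<Rightarrow> real) \<Rightarrow> bool" where
  "same_fdd M Y Z \<longleftrightarrow>
     (\<forall>J. finite J \<longrightarrow>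
        distr M (\<Pi>\<^sub>M t\<in>J. borel) (\<lambda>\<omega>. \<lambda>t\<in>J. Y t \<omega>) =
        distr M (\<Pi>\<^sub>M t\<in>J. borel) (\<lambda>\<omega>. \<lambda>t\<in>J. Z t \<omega>))"

definition stationary_increments :: "'a measure \<Rightarrow> (real \<Rightarrow> 'a \<Rightarrow> real) \<Rightarrow> bool" where
  "stationary_increments M Z \<longleftrightarrow>
     (\<forall>t. Z t \<in> borel_measurable M) \<and>
     (\<forall>s. same_fdd M (\<lambda>t \<omega>. Z t \<omega> - Z 0 \<omega>) (\<lambda>t \<omega>. Z (t + s) \<omega> - Z s \<omega>))"

definition stationary_process :: "'a measure \<Rightarrow> (real \<Rightarrow> 'a \<Rightarrow> real) \<Rightarrow> bool" where
  "stationary_process M Z \<longleftrightarrow>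
     (\<forall>t. Z t \<in> borel_measurable M) \<and> (\<forall>s. same_fdd M Z (\<lambda>t. Z (t + s)))"

definition finite_moments :: "'a measure \<Rightarrow> real \<Rightarrow> (real \<Rightarrow> 'a \<Rightarrow> real) \<Rightarrow> bool" where
  "finite_moments M p Z \<longleftrightarrow> (\<forall>t. integrable M (\<lambda>\<omega>. \<bar>Z t \<omega>\<bar> powr p))"

definition Lp_norm :: "'a measure \<Rightarrow> real \<Rightarrow> ('a \<Rightarrow> real) \<Rightarrow> real" where
  "Lp_norm M p Y = (\<integral>\<omega>. \<bar>Y \<omega>\<bar> powr p \<partial>M) powr (1 / p)"

text \<open>The defining equation is pathwise: outside a single null set it holds for all \<open>t\<close>
  simultaneously, with paths that are Lebesgue integrable between \<open>0\<close> and \<open>t\<close>.  It cannot be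
  required on all of \<open>\<Omega>\<close>, since at \<open>t = 0\<close> it forces \<open>N 0 = 0\<close>, which is only known
  almost surely.  The library's interval integral satisfies the convention
  \<open>\<integral>\<^sub>0\<^sup>t = - \<integral>\<^sub>t\<^sup>0\<close> for \<open>t < 0\<close>.\<close>

definition QOU_process ::
    "'a measure \<Rightarrow> real \<Rightarrow> (real \<Rightarrow> 'a \<Rightarrow> real) \<Rightarrow> (real \<Rightarrow> 'a \<Rightarrow> real) \<Rightarrow> bool" where
  "QOU_process M lam N X \<longleftrightarrow>
     stationary_process M X \<and>
     (AE \<omega> in M. \<forall>t.
        interval_lebesgue_integrable lborel 0 (ereal t) (\<lambda>s. X s \<omega>) \<and>
        X t \<omega> = X 0 \<omega> - lam * (LBINT s=0..ereal t. X s \<omega>) + N t \<omega>)"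

text \<open>The Bochner integral is \<open>0\<close> for non-integrable functions, so the following second-order
  quantities are meaningful only for processes with finite second moments.  A QOU process whose
  driving process has stationary increments and finite \<open>p\<close>-th moments, \<open>p \<ge> 1\<close>, has finite
  \<open>p\<close>-th moments itself.\<close>

definition covar :: "'a measure \<Rightarrow> ('a \<Rightarrow> real) \<Rightarrow> ('a \<Rightarrow> real) \<Rightarrow> real" where
  "covar M Y Z = (\<integral>\<omega>. (Y \<omega> - (\<integral>\<eta>. Y \<eta> \<partial>M)) * (Z \<omega> - (\<integral>\<eta>. Z \<eta> \<partial>M)) \<partial>M)"

definition var_fun :: "'a measure \<Rightarrow> (real \<Rightarrow> 'a \<Rightarrow> real) \<Rightarrow> real \<Rightarrow> real" where
  "var_fun M Z t = prob_space.variance M (Z t)"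

definition autocov :: "'a measure \<Rightarrow> (real \<Rightarrow> 'a \<Rightarrow> real) \<Rightarrow> real \<Rightarrow> real" where
  "autocov M Z t = covar M (Z t) (Z 0)"

definition compl_autocov :: "'a measure \<Rightarrow> (real \<Rightarrow> 'a \<Rightarrow> real) \<Rightarrow> real \<Rightarrow> real" where
  "compl_autocov M Z t = autocov M Z 0 - autocov M Z t"

text \<open>Being \<open>n\<close> times continuously differentiable in a neighbourhood of \<open>\<infinity>\<close>; only there are the
  iterates of \<open>deriv\<close> the classical derivatives.\<close>

definition C_near_infinity :: "nat \<Rightarrow> (real \<Rightarrow> real) \<Rightarrow> bool" where
  "C_near_infinity n f \<longleftrightarrow>
     (\<exists>T. (\<forall>k<n. \<forall>t>T. (deriv ^^ k) f differentiable (at t)) \<and>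
          continuous_on {T<..} ((deriv ^^ n) f))"

end

theory Submission
  imports Defs "HOL-Real_Asymp.Real_Asymp"
begin

text \<open>
  Write \<open>R\<close> for the autocovariance of \<open>X\<close> and \<open>V\<close> for the variance function of \<open>N\<close>. From
  \<open>N t = X t - X 0 + \<lambda> \<integral>\<^sub>0\<^sup>t X\<close> and the evenness of \<open>R\<close> one gets, for \<open>t \<ge> 0\<close>,
  \<open>V t = 2 (R 0 - R t) + 2 \<lambda>\<^sup>2 \<integral>\<^sub>0\<^sup>t \<integral>\<^sub>0\<^sup>s R\<close>. Near \<open>0\<close> the double integral is \<open>O(t\<^sup>2)\<close>, which is the
  second-order part of (ii); the \<open>L\<^sup>p\<close> part follows likewise from Minkowski's inequality and
  \<open>\<parallel>\<integral>\<^sub>0\<^sup>t X\<parallel>\<^sub>p \<le> |t| \<parallel>X 0\<parallel>\<^sub>p\<close>. Near \<open>\<infinity>\<close> the identity makes \<open>R\<close> a bounded solution of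
  \<open>R'' = \<lambda>\<^sup>2 R - V'' / 2\<close>. L'Hopital's rule gives \<open>R' + \<lambda> R \<sim> V'' / (2 \<lambda>)\<close>, comparing
  \<open>(R' + \<lambda> R) e\<^bsup>-\<lambda> t\<^esup>\<close> with \<open>V'' e\<^bsup>-\<lambda> t\<^esup>\<close>, and then \<open>R \<sim> V'' / (2 \<lambda>\<^sup>2)\<close>, comparing
  \<open>R e\<^bsup>\<lambda> t\<^esup>\<close> with \<open>V'' e\<^bsup>\<lambda> t\<^esup>\<close>.

  That \<open>X 0\<close> has \<open>p\<close>-th moments follows from \<open>X 1 = e\<^bsup>-\<lambda>\<^esup> X 0 + W\<close>, where \<open>X 1\<close> and \<open>X 0\<close> are
  equally distributed and \<open>W\<close> is an integral functional of \<open>N\<close> on \<open>[0, 1]\<close>; its \<open>p\<close>-th moment is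
  finite because the moments of a measurable process with stationary increments are locally bounded.
\<close>

subsection \<open>Bounded solutions of a second-order linear equation\<close>

text \<open>The substitution \<open>inverse x\<close> moves the limit to the right of 0, where the
  one-sided rule applies; the factor that the chain rule adds to both derivatives cancels in their
  quotient.\<close>

lemma lhopital_zero_at_top:
  fixes f g :: "real \<Rightarrow> real"
  assumes f_0: "(f \<longlongrightarrow> 0) at_top"
    and g_0: "(g \<longlongrightarrow> 0) at_top"
    and g: "eventually (\<lambda>x. g x \<noteq> 0) at_top"
    and g': "eventually (\<lambda>x. g' x \<noteq> 0) at_top"
    and Df: "eventually (\<lambda>x. DERIV f x :> f' x) at_top"
    and Dg: "eventually (\<lambda>x. DERIV g x :> g' x) at_top"
    and lim: "((\<lambda>x. f' x / g' x) \<longlongrightarrow> L) at_top"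
  shows "((\<lambda>x. f x / g x) \<longlongrightarrow> L) at_top"
  unfolding filterlim_at_top_to_right
proof (rule lhopital_right_0)
  let ?F = "\<lambda>x. f (inverse x)"
  let ?G = "\<lambda>x. g (inverse x)"
  let ?R = "at_right (0::real)"
  let ?D = "\<lambda>f' x. f' (inverse x) * - (inverse x ^ Suc (Suc 0))"
  show "(?F \<longlongrightarrow> 0) ?R" "(?G \<longlongrightarrow> 0) ?R"
    using f_0 g_0 unfolding filterlim_at_top_to_right by auto
  show "eventually (\<lambda>x. ?G x \<noteq> 0) ?R"
    using g unfolding eventually_at_right_to_top by simp
  show "eventually (\<lambda>x. DERIV ?G x  :> ?D g' x) ?R"
    unfolding eventually_at_right_to_top
    using Dg eventually_ge_at_top[where c=1]
    by eventually_elim (rule derivative_eq_intros DERIV_chain'[where f=inverse] | simp)+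
  show "eventually (\<lambda>x. DERIV ?F x  :> ?D f' x) ?R"
    unfolding eventually_at_right_to_top
    using Df eventually_ge_at_top[where c=1]
    by eventually_elim (rule derivative_eq_intros DERIV_chain'[where f=inverse] | simp)+
  show "eventually (\<lambda>x. ?D g' x \<noteq> 0) ?R"
    unfolding eventually_at_right_to_top
    using g' eventually_ge_at_top[where c=1]
    by eventually_elim auto
  show "((\<lambda>x. ?D f' x / ?D g' x) \<longlongrightarrow> L) ?R"
    unfolding filterlim_at_right_to_top
    apply (intro filterlim_cong[THEN iffD2, OF refl refl _ lim])
    using eventually_ge_at_top[where c=1]
    by eventually_elim simp
qed

text \<open>The homogeneous equation has the modes \<open>exp (lam * t)\<close> and
  \<open>exp (- lam * t)\<close>. Boundedness of \<open>R\<close> together with \<open>vO\<close>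
  excludes the growing one, and \<open>vo\<close> makes the decaying one negligible against
  \<open>v\<close>. With \<open>v'o\<close> the quotients of derivatives have explicit
  limits.\<close>

lemma bounded_solution_asymp_pos:
  fixes R R' v v' :: "real \<Rightarrow> real" and lam :: real
  assumes lam: "lam > 0"
    and DR: "eventually (\<lambda>t. (R has_real_derivative R' t) (at t)) at_top"
    and DR': "eventually (\<lambda>t. (R' has_real_derivative lam\<^sup>2 * R t - v t / 2) (at t)) at_top"
    and Dv: "eventually (\<lambda>t. (v has_real_derivative v' t) (at t)) at_top"
    and bdd: "eventually (\<lambda>t. \<bar>R t\<bar> \<le> K) at_top"
    and vO: "v \<in> O[at_top](\<lambda>t. exp (lam / 2 * t))"
    and vo: "(\<lambda>t. exp (- lam * t)) \<in> o[at_top](v)"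
    and v'o: "v' \<in> o[at_top](v)"
    and pos: "eventually (\<lambda>t. v t > 0) at_top"
  shows "((\<lambda>t. R t / v t) \<longlongrightarrow> 1 / (2 * lam\<^sup>2)) at_top"
proof -
  have neg_exp: "((\<lambda>t. exp (- c * t)) \<longlongrightarrow> 0) at_top" if "c > 0" for c :: real
    using that by real_asymp
  have pos_exp: "LIM t at_top. exp (lam * t) :> at_top"
    using lam by real_asymp
  have v_exp: "((\<lambda>t. v t / exp (lam * t)) \<longlongrightarrow> 0) at_top"
  proof -
    have "(\<lambda>t. exp (lam / 2 * t)) \<in> o[at_top](\<lambda>t. exp (lam * t))"
      using lam by real_asymp
    with vO have "v \<in> o[at_top](\<lambda>t. exp (lam * t))"
      by (rule landau_o.big_small_trans)
    then show ?thesis by (rule smalloD_tendsto)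
  qed
  have R_exp: "((\<lambda>t. R t / exp (lam * t)) \<longlongrightarrow> 0) at_top"
  proof (rule Lim_null_comparison)
    show "eventually (\<lambda>t. norm (R t / exp (lam * t)) \<le> K * exp (- lam * t)) at_top"
      using bdd by eventually_elim (simp add: exp_minus field_simps)
    show "((\<lambda>t. K * exp (- lam * t)) \<longlongrightarrow> 0) at_top"
      using tendsto_mult_left[OF neg_exp[OF lam], of K] by simp
  qed
  \<comment> \<open>Nothing is known about the growth of \<open>R'\<close> beforehand. This form of
    L'Hopital's rule asks only the denominator to diverge, and the equation gives the derivative of
    \<open>R'\<close> in terms of \<open>R\<close> and \<open>v\<close>.\<close>
  have R'_exp: "((\<lambda>t. R' t / exp (lam * t)) \<longlongrightarrow> 0) at_top"
  proof (rule lhospital_at_top_at_top[OF pos_exp _ DR'])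
    show "eventually (\<lambda>t. ((\<lambda>t. exp (lam * t)) has_real_derivative lam * exp (lam * t)) (at t)) at_top"
      by (intro always_eventually allI) (auto intro!: derivative_eq_intros)
    have "((\<lambda>t. lam * (R t / exp (lam * t)) - (v t / exp (lam * t)) / (2 * lam)) \<longlongrightarrow> lam * 0 - 0 / (2 * lam)) at_top"
      using lam by (intro tendsto_intros R_exp v_exp) auto
    also have "(\<lambda>t. lam * (R t / exp (lam * t)) - (v t / exp (lam * t)) / (2 * lam)) =
        (\<lambda>t. (lam\<^sup>2 * R t - v t / 2) / (lam * exp (lam * t)))"
      using lam by (auto simp: field_simps power2_eq_square)
    finally show "((\<lambda>t. (lam\<^sup>2 * R t - v t / 2) / (lam * exp (lam * t))) \<longlongrightarrow> 0) at_top"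
      by simp
  qed (use lam in auto)
  have ratio: "((\<lambda>t. v' t / v t) \<longlongrightarrow> 0) at_top"
    using v'o by (rule smalloD_tendsto)
  \<comment> \<open>Keeps \<open>v' t / v t\<close> away from both \<open>lam\<close> and
    \<open>- lam\<close>, so neither denominator below has a vanishing derivative.\<close>
  have small: "eventually (\<lambda>t. \<bar>v' t / v t\<bar> < lam / 2) at_top"
    using tendstoD[OF ratio, of "lam / 2"] lam by (simp add: dist_real_def)
  \<comment> \<open>Factor the second-order operator as (D - lam)(D + lam): \<open>u\<close> solves
    a first-order equation with source \<open>- v / 2\<close>, and \<open>R\<close> then solves a
    first-order equation with source \<open>u\<close>.\<close>
  define u where "u t = R' t + lam * R t" for t
  have Du: "eventually (\<lambda>t. (u has_real_derivative lam * u t - v t / 2) (at t)) at_top"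
    using DR DR'
  proof eventually_elim
    case (elim t)
    show ?case
      unfolding u_def using elim
      by (auto intro!: derivative_eq_intros simp: algebra_simps power2_eq_square)
  qed
  \<comment> \<open>The integrating factor removes the linear term from the derivative of the
    numerator. Both functions tend to 0, and the quotient of derivatives is
    \<open>- (1 / 2) / (v' t / v t - lam)\<close>.\<close>
  have "((\<lambda>t. (u t * exp (- lam * t)) / (v t * exp (- lam * t))) \<longlongrightarrow> 1 / (2 * lam)) at_top"
  proof (rule lhopital_zero_at_top)
    have "((\<lambda>t. R' t / exp (lam * t) + lam * (R t / exp (lam * t))) \<longlongrightarrow> 0 + lam * 0) at_top"
      by (intro tendsto_intros R_exp R'_exp)
    then show "((\<lambda>t. u t * exp (- lam * t)) \<longlongrightarrow> 0) at_top"
      by (simp add: u_def exp_minus field_simps)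
    show "((\<lambda>t. v t * exp (- lam * t)) \<longlongrightarrow> 0) at_top"
      using v_exp by (simp add: exp_minus field_simps)
    show "eventually (\<lambda>t. v t * exp (- lam * t) \<noteq> 0) at_top"
      using pos by eventually_elim auto
    show "eventually (\<lambda>t. (v' t - lam * v t) * exp (- lam * t) \<noteq> 0) at_top"
      using pos small
    proof eventually_elim
      case (elim t)
      have "v' t / v t \<noteq> lam" using elim(2)[unfolded abs_less_iff] lam by linarith
      then show ?case using elim(1) by auto
    qed
    show "eventually (\<lambda>t. ((\<lambda>t. u t * exp (- lam * t)) has_real_derivative - v t / 2 * exp (- lam * t)) (at t)) at_top"
      using Du by eventually_elim (auto intro!: derivative_eq_intros simp: algebra_simps)
    show "eventually (\<lambda>t. ((\<lambda>t. v t * exp (- lam * t)) has_real_derivative (v' t - lam * v t) * exp (- lam * t)) (at t)) at_top"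
      using Dv by eventually_elim (auto intro!: derivative_eq_intros simp: algebra_simps)
    have "((\<lambda>t. - (1 / 2) / (v' t / v t - lam)) \<longlongrightarrow> - (1 / 2) / (0 - lam)) at_top"
      using lam by (intro tendsto_intros ratio) auto
    moreover have "eventually (\<lambda>t. - (1 / 2) / (v' t / v t - lam) =
        (- v t / 2 * exp (- lam * t)) / ((v' t - lam * v t) * exp (- lam * t))) at_top"
      using pos
    proof eventually_elim
      case (elim t)
      have "v' t - lam * v t = v t * (v' t / v t - lam)" using elim by (simp add: field_simps)
      then show ?case using elim by simp
    qed
    ultimately show "((\<lambda>t. (- v t / 2 * exp (- lam * t)) / ((v' t - lam * v t) * exp (- lam * t)))
        \<longlongrightarrow> 1 / (2 * lam)) at_top"
      using Lim_transform_eventually by fastforce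
  qed
  then have u_v: "((\<lambda>t. u t / v t) \<longlongrightarrow> 1 / (2 * lam)) at_top" by simp
  \<comment> \<open>The opposite integrating factor turns the derivative of the numerator into
    \<open>u t * exp (lam * t)\<close>; the denominator diverges by \<open>vo\<close>.\<close>
  have "((\<lambda>t. (R t * exp (lam * t)) / (v t * exp (lam * t))) \<longlongrightarrow> 1 / (2 * lam\<^sup>2)) at_top"
  proof (rule lhospital_at_top_at_top)
    have "((\<lambda>t. exp (- lam * t) / v t) \<longlongrightarrow> 0) at_top"
      using vo by (rule smalloD_tendsto)
    moreover have "eventually (\<lambda>t. exp (- lam * t) / v t > 0) at_top"
      using pos by eventually_elim auto
    ultimately have "LIM t at_top. inverse (exp (- lam * t) / v t) :> at_top"
      by (rule filterlim_inverse_at_top)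
    then show "LIM t at_top. v t * exp (lam * t) :> at_top"
      by (simp add: exp_minus field_simps)
    show "eventually (\<lambda>t. (v' t + lam * v t) * exp (lam * t) \<noteq> 0) at_top"
      using pos small
    proof eventually_elim
      case (elim t)
      have "v' t / v t \<noteq> - lam" using elim(2)[unfolded abs_less_iff] lam by linarith
      moreover have "v' t + lam * v t = v t * (v' t / v t + lam)" using elim by (simp add: field_simps)
      ultimately show ?case using elim(1) by auto
    qed
    show "eventually (\<lambda>t. ((\<lambda>t. R t * exp (lam * t)) has_real_derivative u t * exp (lam * t)) (at t)) at_top"
      using DR by eventually_elim (auto intro!: derivative_eq_intros simp: u_def algebra_simps)
    show "eventually (\<lambda>t. ((\<lambda>t. v t * exp (lam * t)) has_real_derivative (v' t + lam * v t) * exp (lam * t)) (at t)) at_top"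
      using Dv by eventually_elim (auto intro!: derivative_eq_intros simp: algebra_simps)
    have "((\<lambda>t. (u t / v t) / (v' t / v t + lam)) \<longlongrightarrow> (1 / (2 * lam)) / (0 + lam)) at_top"
      using lam by (intro tendsto_intros ratio u_v) auto
    moreover have "eventually (\<lambda>t. (u t / v t) / (v' t / v t + lam) =
        (u t * exp (lam * t)) / ((v' t + lam * v t) * exp (lam * t))) at_top"
      using pos
    proof eventually_elim
      case (elim t)
      have "v' t + lam * v t = v t * (v' t / v t + lam)" using elim by (simp add: field_simps)
      then show ?case using elim by simp
    qed
    ultimately show "((\<lambda>t. (u t * exp (lam * t)) / ((v' t + lam * v t) * exp (lam * t)))
        \<longlongrightarrow> 1 / (2 * lam\<^sup>2)) at_top"
      using Lim_transform_eventually by (fastforce simp: power2_eq_square mult.assoc)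
  qed
  then show ?thesis by simp
qed

text \<open>By \<open>vo\<close> the function \<open>v\<close> has no zeros near infinity, so by
  continuity it has a fixed sign there. The equation is linear, so a negative \<open>v\<close> is
  treated by negating \<open>R\<close> and \<open>v\<close> together.\<close>

lemma bounded_solution_asymp:
  fixes R R' v v' :: "real \<Rightarrow> real" and lam :: real
  assumes lam: "lam > 0"
    and DR: "eventually (\<lambda>t. (R has_real_derivative R' t) (at t)) at_top"
    and DR': "eventually (\<lambda>t. (R' has_real_derivative lam\<^sup>2 * R t - v t / 2) (at t)) at_top"
    and Dv: "eventually (\<lambda>t. (v has_real_derivative v' t) (at t)) at_top"
    and bdd: "eventually (\<lambda>t. \<bar>R t\<bar> \<le> K) at_top"
    and vO: "v \<in> O[at_top](\<lambda>t. exp (lam / 2 * t))"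
    and vo: "(\<lambda>t. exp (- lam * t)) \<in> o[at_top](v)"
    and v'o: "v' \<in> o[at_top](v)"
  shows "R \<sim>[at_top] (\<lambda>t. 1 / (2 * lam\<^sup>2) * v t)"
proof -
  have nz: "eventually (\<lambda>t. v t \<noteq> 0) at_top"
    using landau_o.smallD[OF vo zero_less_one] by eventually_elim auto
  obtain T where T: "\<And>t. t \<ge> T \<Longrightarrow> v t \<noteq> 0 \<and> (v has_real_derivative v' t) (at t)"
    using eventually_conj[OF nz Dv] unfolding eventually_at_top_linorder by auto
  have cont: "continuous_on {T..} v"
    using T by (intro continuous_at_imp_continuous_on) (auto dest: DERIV_isCont)
  have "connected (v ` {T..})"
    by (intro connected_continuous_image cont) auto
  then have sign: "(\<forall>t\<ge>T. v t > 0) \<or> (\<forall>t\<ge>T. v t < 0)"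
    using T unfolding connected_iff_interval
    by (smt (verit, best) atLeast_iff image_iff)
  have lim: "((\<lambda>t. R t / v t) \<longlongrightarrow> 1 / (2 * lam\<^sup>2)) at_top"
    using sign
  proof
    assume "\<forall>t\<ge>T. v t > 0"
    then have "eventually (\<lambda>t. v t > 0) at_top"
      unfolding eventually_at_top_linorder by auto
    then show ?thesis
      by (rule bounded_solution_asymp_pos[OF lam DR DR' Dv bdd vO vo v'o])
  next
    assume "\<forall>t\<ge>T. v t < 0"
    then have neg: "eventually (\<lambda>t. - v t > 0) at_top"
      unfolding eventually_at_top_linorder by auto
    have "((\<lambda>t. (- R t) / (- v t)) \<longlongrightarrow> 1 / (2 * lam\<^sup>2)) at_top"
    proof (rule bounded_solution_asymp_pos[OF lam _ _ _ _ _ _ _ neg])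
      show "eventually (\<lambda>t. ((\<lambda>t. - R t) has_real_derivative - R' t) (at t)) at_top"
        using DR by eventually_elim (auto intro!: derivative_eq_intros)
      show "eventually (\<lambda>t. ((\<lambda>t. - R' t) has_real_derivative lam\<^sup>2 * - R t - - v t / 2) (at t)) at_top"
        using DR' by eventually_elim (auto intro!: derivative_eq_intros)
      show "eventually (\<lambda>t. ((\<lambda>t. - v t) has_real_derivative - v' t) (at t)) at_top"
        using Dv by eventually_elim (auto intro!: derivative_eq_intros)
    qed (use bdd vO vo v'o in auto)
    then show ?thesis by simp
  qed
  have "((\<lambda>t. 2 * lam\<^sup>2 * (R t / v t)) \<longlongrightarrow> 2 * lam\<^sup>2 * (1 / (2 * lam\<^sup>2))) at_top"
    by (intro tendsto_intros lim)
  then have "((\<lambda>t. R t / (1 / (2 * lam\<^sup>2) * v t)) \<longlongrightarrow> 1) at_top"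
    using lam by (simp add: field_simps)
  then show ?thesis
    by (rule asymp_equivI')
qed

subsection \<open>The resolvent of a linear Volterra equation\<close>

text \<open>Fubini on the triangle \<open>0 \<le> r \<le> s \<le> t\<close>: integrating over
  \<open>s\<close> first gives \<open>(exp (lam * t) - exp (lam * r)) / lam\<close> as the weight of
  \<open>x r\<close>.\<close>

lemma exp_integral_triangle:
  fixes x :: "real \<Rightarrow> real" and lam t :: real
  assumes lam: "lam > 0" and t: "t \<ge> 0" and x: "set_integrable lborel {0..t} x"
  shows "set_integrable lborel {0..t} (\<lambda>s. exp (lam * s) * (LINT r:{0..s}|lborel. x r))"
    and "lam * (LINT s:{0..t}|lborel. exp (lam * s) * (LINT r:{0..s}|lborel. x r)) =
      exp (lam * t) * (LINT r:{0..t}|lborel. x r) - (LINT r:{0..t}|lborel. exp (lam * r) * x r)"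
proof -
  define xi where "xi r = indicator {0..t} r * x r" for r :: real
  have xi: "integrable lborel xi"
    using x unfolding set_integrable_def xi_def by simp
  have [measurable]: "xi \<in> borel_measurable borel" using xi by simp
  define f where "f s r = indicator {0..t} s * indicator {..s} r * exp (lam * s) * xi r" for s r :: real
  have [measurable]: "Measurable.pred (borel \<Otimes>\<^sub>M borel) (\<lambda>z::real \<times> real. snd z \<in> {..fst z})"
    unfolding atMost_iff by measurable
  have fm [measurable]: "case_prod f \<in> borel_measurable (borel \<Otimes>\<^sub>M borel)"
    unfolding f_def case_prod_beta by measurable
  \<comment> \<open>On the square the integrand is dominated by the product of the constant
    \<open>exp (lam * t)\<close> and \<open>xi r\<close>, which is integrable because
    \<open>xi\<close> is \<open>x\<close> cut off outside \<open>{0..t}\<close>.\<close>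
  have f: "integrable (lborel \<Otimes>\<^sub>M lborel) (case_prod f)"
  proof (rule Bochner_Integration.integrable_bound)
    show "integrable (lborel \<Otimes>\<^sub>M lborel) (\<lambda>(s, r). (indicator {0..t} s * exp (lam * t)) * xi r)"
    proof (rule lborel_pair.Fubini_integrable)
      have "integrable lborel (\<lambda>s. indicator {0..t} s * (exp (lam * t) * (LINT r|lborel. \<bar>xi r\<bar>)))"
        by (intro integrable_mult_left integrable_real_indicator) (auto simp: emeasure_lborel_Icc_eq)
      then show "integrable lborel (\<lambda>s. LINT r|lborel. norm (case (s, r) of (s, r) \<Rightarrow> (indicator {0..t} s * exp (lam * t)) * xi r))"
        by (simp add: abs_mult mult.assoc)
    qed (use xi in auto)
    show "case_prod f \<in> borel_measurable (lborel \<Otimes>\<^sub>M lborel)" by measurable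
    show "AE z in lborel \<Otimes>\<^sub>M lborel. norm (case_prod f z) \<le> norm (case z of (s, r) \<Rightarrow> (indicator {0..t} s * exp (lam * t)) * xi r)"
      using lam by (intro AE_I2) (auto simp: f_def indicator_def abs_mult split: prod.splits intro!: mult_right_mono)
  qed
  have inner1: "(LINT r|lborel. f s r) = indicator {0..t} s * (exp (lam * s) * (LINT r:{0..s}|lborel. x r))" for s
  proof (cases "s \<in> {0..t}")
    case True
    have "(LINT r|lborel. f s r) = (LINT r|lborel. exp (lam * s) * (indicator {0..s} r * x r))"
      using True by (intro Bochner_Integration.integral_cong) (auto simp: f_def xi_def indicator_def)
    then show ?thesis using True by (simp add: set_lebesgue_integral_def)
  qed (simp add: f_def)
  have inner2: "(LINT s|lborel. f s r) = (exp (lam * t) / lam) * xi r - (1 / lam) * (indicator {0..t} r * (exp (lam * r) * x r))" for r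
  proof (cases "r \<in> {0..t}")
    case True
    have "(LINT s|lborel. f s r) = (LINT s|lborel. xi r * (exp (lam * s) * indicator {r..t} s))"
      using True by (intro Bochner_Integration.integral_cong) (auto simp: f_def xi_def indicator_def)
    also have "\<dots> = xi r * (exp (lam * t) / lam - exp (lam * r) / lam)"
      using True lam
      by (subst integral_mult_right_zero, subst integral_FTC_Icc_real[where F="\<lambda>s. exp (lam * s) / lam"])
         (auto intro!: derivative_eq_intros)
    finally show ?thesis using True by (simp add: xi_def field_simps)
  qed (simp add: f_def xi_def)
  show "set_integrable lborel {0..t} (\<lambda>s. exp (lam * s) * (LINT r:{0..s}|lborel. x r))"
    using lborel_pair.integrable_fst[OF f] by (simp add: inner1 set_integrable_def)
  have ex: "integrable lborel (\<lambda>r. indicator {0..t} r * (exp (lam * r) * x r))"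
  proof (rule Bochner_Integration.integrable_bound)
    show "integrable lborel (\<lambda>r. exp (lam * t) * xi r)" using xi by simp
    have "(\<lambda>r. indicator {0..t} r * (exp (lam * r) * x r)) = (\<lambda>r. exp (lam * r) * xi r)"
      by (auto simp: xi_def)
    also have "\<dots> \<in> borel_measurable lborel" by measurable
    finally show "(\<lambda>r. indicator {0..t} r * (exp (lam * r) * x r)) \<in> borel_measurable lborel" .
    show "AE r in lborel. norm (indicator {0..t} r * (exp (lam * r) * x r)) \<le> norm (exp (lam * t) * xi r)"
      using lam by (auto simp: xi_def indicator_def abs_mult intro!: mult_right_mono)
  qed
  have "(LINT s:{0..t}|lborel. exp (lam * s) * (LINT r:{0..s}|lborel. x r)) = (LINT s|lborel. LINT r|lborel. f s r)"
    by (simp add: inner1 set_lebesgue_integral_def)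
  also have "\<dots> = (LINT r|lborel. LINT s|lborel. f s r)"
    using lborel_pair.integral_fst[OF f] lborel_pair.integral_snd[OF f] by simp
  also have "\<dots> = (exp (lam * t) / lam) * (LINT r|lborel. xi r) - (1 / lam) * (LINT r:{0..t}|lborel. exp (lam * r) * x r)"
    using xi ex by (simp add: inner2 set_lebesgue_integral_def)
  finally show "lam * (LINT s:{0..t}|lborel. exp (lam * s) * (LINT r:{0..s}|lborel. x r)) =
      exp (lam * t) * (LINT r:{0..t}|lborel. x r) - (LINT r:{0..t}|lborel. exp (lam * r) * x r)"
    using lam by (simp add: set_lebesgue_integral_def xi_def field_simps)
qed

text \<open>Multiply the equation by \<open>exp (lam * s)\<close> and integrate over
  \<open>{0..t}\<close>. By the triangle identity the integrals of
  \<open>exp (lam * s) * x s\<close> cancel, which expresses \<open>J t\<close>, and hence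
  \<open>x t\<close>, through \<open>x0\<close> and \<open>n\<close> alone.\<close>

lemma volterra_solution:
  fixes x n :: "real \<Rightarrow> real" and lam t x0 :: real
  assumes lam: "lam > 0" and t: "t \<ge> 0" and x: "set_integrable lborel {0..t} x"
    and eq: "\<And>s. 0 \<le> s \<Longrightarrow> s \<le> t \<Longrightarrow> x s = x0 - lam * (LINT r:{0..s}|lborel. x r) + n s"
  shows "x t = n t + exp (- lam * t) * x0 - lam * (LINT s:{0..t}|lborel. exp (- lam * (t - s)) * n s)"
proof -
  define J where "J s = (LINT r:{0..s}|lborel. x r)" for s
  note tri = exp_integral_triangle[OF lam t x, folded J_def]
  have e: "set_integrable lborel {0..t} (\<lambda>s. exp (lam * s))"
    by (intro borel_integrable_atLeastAtMost') (auto intro!: continuous_intros)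
  have e_int: "(LINT s:{0..t}|lborel. exp (lam * s)) = exp (lam * t) / lam - 1 / lam"
  proof -
    have "(LINT s|lborel. exp (lam * s) * indicator {0..t} s) = exp (lam * t) / lam - exp (lam * 0) / lam"
      using t lam by (intro integral_FTC_Icc_real) (auto intro!: derivative_eq_intros)
    then show ?thesis by (simp add: set_lebesgue_integral_def mult.commute)
  qed
  have ex: "set_integrable lborel {0..t} (\<lambda>s. exp (lam * s) * x s)"
    unfolding set_integrable_def
  proof (rule Bochner_Integration.integrable_bound)
    show "integrable lborel (\<lambda>r. exp (lam * t) * (indicator {0..t} r * x r))"
      using x by (simp add: set_integrable_def)
    have "(\<lambda>r. indicator {0..t} r * x r) \<in> borel_measurable lborel"
      using x by (auto simp: set_integrable_def)
    then have "(\<lambda>r. exp (lam * r) * (indicator {0..t} r * x r)) \<in> borel_measurable lborel"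
      by measurable
    then show "(\<lambda>r. indicat_real {0..t} r *\<^sub>R (exp (lam * r) * x r)) \<in> borel_measurable lborel"
      by (simp add: algebra_simps)
    show "AE r in lborel. norm (indicat_real {0..t} r *\<^sub>R (exp (lam * r) * x r)) \<le> norm (exp (lam * t) * (indicator {0..t} r * x r))"
      using lam by (auto simp: indicator_def abs_mult intro!: mult_right_mono)
  qed
  have "(LINT s:{0..t}|lborel. exp (lam * s) * n s) =
      (LINT s:{0..t}|lborel. exp (lam * s) * x s - x0 * exp (lam * s) + lam * (exp (lam * s) * J s))"
    by (intro set_lebesgue_integral_cong) (auto simp: eq J_def algebra_simps)
  also have "\<dots> = (LINT s:{0..t}|lborel. exp (lam * s) * x s) - x0 * (LINT s:{0..t}|lborel. exp (lam * s))
      + lam * (LINT s:{0..t}|lborel. exp (lam * s) * J s)"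
    using ex e tri(1) by (simp add: set_integral_add set_integral_diff)
  also have "\<dots> = exp (lam * t) * J t - x0 * (exp (lam * t) / lam - 1 / lam)"
    by (simp add: tri(2) e_int)
  finally have I: "(LINT s:{0..t}|lborel. exp (lam * s) * n s) = exp (lam * t) * J t - x0 * (exp (lam * t) / lam - 1 / lam)" .
  have "(LINT s:{0..t}|lborel. exp (- lam * (t - s)) * n s) = (LINT s:{0..t}|lborel. exp (- lam * t) * (exp (lam * s) * n s))"
    by (intro set_lebesgue_integral_cong) (auto simp: algebra_simps simp flip: exp_add)
  also have "\<dots> = exp (- lam * t) * (exp (lam * t) * J t - x0 * (exp (lam * t) / lam - 1 / lam))"
    by (simp add: I)
  also have "\<dots> = J t - x0 * (1 / lam - exp (- lam * t) / lam)"
    by (simp add: algebra_simps exp_minus)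
  finally have K: "(LINT s:{0..t}|lborel. exp (- lam * (t - s)) * n s) = J t - x0 * (1 / lam - exp (- lam * t) / lam)" .
  show ?thesis
    unfolding K using eq[of t] t lam by (simp add: J_def algebra_simps)
qed

subsection \<open>Convexity and \<open>L\<^sup>p\<close> inequalities\<close>

text \<open>Convexity of the power function: its graph lies above the tangent at \<open>a\<close>.
  For positive \<open>y\<close> this is Young's inequality for \<open>y powr p\<close> and
  \<open>a powr p\<close> with weights \<open>1 / p\<close> and \<open>1 - 1 / p\<close>.\<close>

lemma powr_tangent_le:
  fixes a p y :: real
  assumes "p \<ge> 1" "a > 0" "y \<ge> 0"
  shows "a powr p + p * a powr (p - 1) * (y - a) \<le> y powr p"
proof (cases "y = 0")
  case True
  have "a powr p = a powr (p - 1) * a"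
    using powr_add[of a "p - 1" 1] assms by simp
  moreover have "a powr (p - 1) * a \<ge> 0" using assms by simp
  ultimately show ?thesis using True assms mult_right_mono[of 1 p "a powr (p - 1) * a"] by simp
next
  case False
  have "(y powr p) powr (1 / p) * (a powr p) powr (1 - 1 / p) \<le> 1 / p * y powr p + (1 - 1 / p) * a powr p"
    using assms False by (intro Youngs_inequality_0) (auto simp: field_simps)
  moreover have "(a powr p) powr (1 - 1 / p) = a powr (p - 1)"
    using assms by (simp add: powr_powr right_diff_distrib)
  moreover have "(y powr p) powr (1 / p) = y"
    using assms False by (simp add: powr_powr)
  ultimately have *: "y * a powr (p - 1) \<le> 1 / p * y powr p + (1 - 1 / p) * a powr p" by simp
  have "p * (y * a powr (p - 1)) \<le> y powr p + (p - 1) * a powr p"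
  proof -
    have "p * (1 / p * b + (1 - 1 / p) * c) = b + (p - 1) * c" for b c
      using assms by (simp add: field_simps)
    then show ?thesis using mult_left_mono[OF *, of p] assms by simp
  qed
  moreover have "a powr p = a powr (p - 1) * a"
    using powr_add[of a "p - 1" 1] assms by simp
  ultimately show ?thesis by (simp add: algebra_simps)
qed

lemma convex_abs_powr:
  fixes p u w x y :: real
  assumes p: "p \<ge> 1" and uw: "u \<ge> 0" "w \<ge> 0" "u + w = 1"
  shows "\<bar>u * x + w * y\<bar> powr p \<le> u * \<bar>x\<bar> powr p + w * \<bar>y\<bar> powr p"
proof -
  define a where "a = u * \<bar>x\<bar> + w * \<bar>y\<bar>"
  have "\<bar>u * x + w * y\<bar> \<le> a"
    using uw by (auto simp: a_def abs_mult intro!: order_trans[OF abs_triangle_ineq])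
  then have le: "\<bar>u * x + w * y\<bar> powr p \<le> a powr p"
    using p by (intro powr_mono2) auto
  show ?thesis
  proof (cases "a > 0")
    case True
    \<comment> \<open>Average the two tangent inequalities at the weighted mean \<open>a\<close>;
      the first-order terms cancel by the choice of \<open>a\<close>.\<close>
    have "a powr p = u * (a powr p + p * a powr (p - 1) * (\<bar>x\<bar> - a)) + w * (a powr p + p * a powr (p - 1) * (\<bar>y\<bar> - a))"
    proof -
      have w: "w = 1 - u" using uw by simp
      show ?thesis unfolding a_def w by algebra
    qed
    also have "\<dots> \<le> u * \<bar>x\<bar> powr p + w * \<bar>y\<bar> powr p"
      using uw p True by (intro add_mono mult_left_mono powr_tangent_le) auto
    finally show ?thesis using le by simp
  next
    case False
    then have "a = 0" using uw by (auto simp: a_def not_less intro!: antisym)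
    then show ?thesis using le uw by (smt (verit) mult_nonneg_nonneg powr_ge_zero powr_zero_eq_one powr_0)
  qed
qed

text \<open>Convexity at the midpoint, with a constant that is cruder than the sharp
  \<open>2 powr (p - 1)\<close>.\<close>

lemma abs_add_powr_le:
  fixes p x y :: real
  assumes "p \<ge> 1"
  shows "\<bar>x + y\<bar> powr p \<le> 2 powr p * (\<bar>x\<bar> powr p + \<bar>y\<bar> powr p)"
proof -
  have "\<bar>x + y\<bar> powr p = 2 powr p * \<bar>1 / 2 * x + 1 / 2 * y\<bar> powr p"
  proof -
    have "\<bar>x + y\<bar> = 2 * \<bar>(x + y) / 2\<bar>" by simp
    also have "(x + y) / 2 = 1 / 2 * x + 1 / 2 * y" by simp
    finally have "\<bar>x + y\<bar> = 2 * \<bar>1 / 2 * x + 1 / 2 * y\<bar>" .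
    then show ?thesis by (metis abs_ge_zero powr_mult zero_le_numeral)
  qed
  also have "\<dots> \<le> 2 powr p * (1 / 2 * \<bar>x\<bar> powr p + 1 / 2 * \<bar>y\<bar> powr p)"
    using assms by (intro mult_left_mono convex_abs_powr) auto
  also have "\<dots> \<le> 2 powr p * (\<bar>x\<bar> powr p + \<bar>y\<bar> powr p)"
    using powr_ge_zero[of "\<bar>x\<bar>" p] powr_ge_zero[of "\<bar>y\<bar>" p]
    by (intro mult_left_mono) (linarith, simp)
  finally show ?thesis .
qed

text \<open>No integrability of \<open>f\<close> is needed: otherwise the Bochner integral on the left is \<open>0\<close>.\<close>

lemma integral_abs_powr_le:
  fixes f :: "real \<Rightarrow> real"
  assumes [measurable]: "f \<in> borel_measurable borel" and p: "p \<ge> 1" and t: "t \<ge> 0"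
  shows "ennreal (\<bar>LINT s:{0..t}|lborel. f s\<bar> powr p) \<le>
    ennreal (t powr (p - 1)) * (\<integral>\<^sup>+s\<in>{0..t}. ennreal (\<bar>f s\<bar> powr p) \<partial>lborel)"
proof -
  let ?I = "LINT s:{0..t}|lborel. f s"
  \<comment> \<open>The first case includes \<open>t = 0\<close>, and in the second the right-hand
    side is infinite. Only the third carries content: Jensen's inequality.\<close>
  consider "?I = 0" | "t > 0" "\<not> set_integrable lborel {0..t} (\<lambda>s. \<bar>f s\<bar> powr p)"
    | "t > 0" "?I \<noteq> 0" "set_integrable lborel {0..t} (\<lambda>s. \<bar>f s\<bar> powr p)"
  proof (cases "t = 0")
    case True
    have "?I = (LINT s:{}|lborel. f s)"
      using True by (intro set_integral_discrete_difference[where X="{0}"]) auto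
    then show ?thesis using that by (simp add: set_lebesgue_integral_def)
  next
    case False
    then show ?thesis using t that by fastforce
  qed
  then show ?thesis
  proof cases
    case 1
    then show ?thesis using p by simp
  next
    case 2
    have "(\<integral>\<^sup>+s\<in>{0..t}. ennreal (\<bar>f s\<bar> powr p) \<partial>lborel) = (\<integral>\<^sup>+s. ennreal (norm (indicator {0..t} s *\<^sub>R \<bar>f s\<bar> powr p)) \<partial>lborel)"
      by (intro nn_integral_cong) (auto simp: indicator_def)
    also have "\<dots> = \<infinity>"
      using 2 unfolding set_integrable_def integrable_iff_bounded by (simp add: less_top[symmetric])
    finally show ?thesis using 2 by (simp add: ennreal_mult_top)
  next
    case 3
    have f: "set_integrable lborel {0..t} f"
      using 3(2) not_integrable_integral_eq unfolding set_lebesgue_integral_def set_integrable_def by blast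
    have fa: "set_integrable lborel {0..t} (\<lambda>s. \<bar>f s\<bar>)" by (rule set_integrable_abs[OF f])
    \<comment> \<open>Jensen's inequality comes from integrating the tangent inequality at this mean
      value. The first-order term is nonnegative because \<open>t * a\<close> is the absolute value
      of the integral, hence at most the integral of the absolute value.\<close>
    define a where "a = \<bar>?I\<bar> / t"
    have a: "a > 0" using 3 by (simp add: a_def)
    have const: "set_integrable lborel {0..t} (\<lambda>s. c)" for c :: real
      unfolding set_integrable_def by (intro integrable_real_indicator integrable_scaleR_left) (auto simp: emeasure_lborel_Icc_eq)
    have const_int: "(LINT s:{0..t}|lborel. c) = t * c" for c :: real
      using t by (simp add: set_lebesgue_integral_def)
    have "t * a powr p \<le> t * a powr p + p * a powr (p - 1) * ((LINT s:{0..t}|lborel. \<bar>f s\<bar>) - t * a)"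
    proof -
      have "\<bar>?I\<bar> \<le> (LINT s:{0..t}|lborel. \<bar>f s\<bar>)"
        using set_integral_norm_bound[OF f] by simp
      then show ?thesis using 3 p by (auto simp: a_def)
    qed
    also have "\<dots> = (LINT s:{0..t}|lborel. a powr p + p * a powr (p - 1) * (\<bar>f s\<bar> - a))"
      using fa const by (simp add: set_integral_add set_integral_diff const_int set_integrable_mult_right)
    also have "\<dots> \<le> (LINT s:{0..t}|lborel. \<bar>f s\<bar> powr p)"
      using fa const 3 p a
      by (intro set_integral_mono set_integral_add set_integrable_mult_right set_integral_diff powr_tangent_le) auto
    finally have "t powr (p - 1) * (t * a powr p) \<le> t powr (p - 1) * (LINT s:{0..t}|lborel. \<bar>f s\<bar> powr p)"
      by (rule mult_left_mono) auto
    moreover have "t powr (p - 1) * (t * a powr p) = \<bar>?I\<bar> powr p"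
    proof -
      have "t powr (p - 1) * t = t powr p" using powr_add[of t "p - 1" 1] 3 by simp
      then have "t powr (p - 1) * (t * a powr p) = t powr p * a powr p" by simp
      also have "\<dots> = (t * a) powr p" using 3 a by (simp add: powr_mult)
      finally show ?thesis using 3 by (simp add: a_def)
    qed
    ultimately have le: "\<bar>?I\<bar> powr p \<le> t powr (p - 1) * (LINT s:{0..t}|lborel. \<bar>f s\<bar> powr p)" by simp
    have "(\<integral>\<^sup>+s\<in>{0..t}. ennreal (\<bar>f s\<bar> powr p) \<partial>lborel) = (\<integral>\<^sup>+s. ennreal (indicator {0..t} s *\<^sub>R \<bar>f s\<bar> powr p) \<partial>lborel)"
      by (intro nn_integral_cong) (auto simp: indicator_def)
    also have "\<dots> = ennreal (LINT s:{0..t}|lborel. \<bar>f s\<bar> powr p)"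
      using 3(3) unfolding set_integrable_def set_lebesgue_integral_def
      by (intro nn_integral_eq_integral) auto
    finally show ?thesis using le by (simp add: ennreal_mult'[symmetric] ennreal_leI)
  qed
qed

section \<open>Minkowski's inequality for \<open>Lp_norm\<close>\<close>

lemma powr_inverse_exponent_mono:
  fixes A b p :: real
  assumes "p \<ge> 1" "0 \<le> A" "0 \<le> b" "A \<le> b powr p"
  shows "A powr (1 / p) \<le> b"
proof -
  have "A powr (1 / p) \<le> (b powr p) powr (1 / p)"
    using assms by (intro powr_mono2) auto
  then show ?thesis using assms by (simp add: powr_powr)
qed

lemma Lp_norm_nonneg: "Lp_norm M p Y \<ge> 0"
  by (simp add: Lp_norm_def)

lemma Lp_norm_powr:
  assumes "p \<ge> 1"
  shows "Lp_norm M p Y powr p = (\<integral>\<omega>. \<bar>Y \<omega>\<bar> powr p \<partial>M)"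
  using assms by (simp add: Lp_norm_def powr_powr)

lemma integrable_abs_powr_add:
  fixes Y Z :: "'a \<Rightarrow> real"
  assumes p: "p \<ge> 1" and [measurable]: "Y \<in> borel_measurable M" "Z \<in> borel_measurable M"
    and Y: "integrable M (\<lambda>\<omega>. \<bar>Y \<omega>\<bar> powr p)" and Z: "integrable M (\<lambda>\<omega>. \<bar>Z \<omega>\<bar> powr p)"
  shows "integrable M (\<lambda>\<omega>. \<bar>Y \<omega> + Z \<omega>\<bar> powr p)"
proof (rule Bochner_Integration.integrable_bound)
  show "integrable M (\<lambda>\<omega>. 2 powr p * (\<bar>Y \<omega>\<bar> powr p + \<bar>Z \<omega>\<bar> powr p))"
    using Y Z by simp
  show "AE \<omega> in M. norm (\<bar>Y \<omega> + Z \<omega>\<bar> powr p) \<le> norm (2 powr p * (\<bar>Y \<omega>\<bar> powr p + \<bar>Z \<omega>\<bar> powr p))"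
    using abs_add_powr_le[OF p] by simp
qed measurable

text \<open>Normalise \<open>Y\<close> by \<open>a\<close> and \<open>Z\<close> by \<open>b\<close>,
  just above their norms, and apply convexity with weights \<open>a / (a + b)\<close> and
  \<open>b / (a + b)\<close>.\<close>

lemma Lp_norm_triangle:
  fixes Y Z :: "'a \<Rightarrow> real"
  assumes p: "p \<ge> 1" and [measurable]: "Y \<in> borel_measurable M" "Z \<in> borel_measurable M"
    and Y: "integrable M (\<lambda>\<omega>. \<bar>Y \<omega>\<bar> powr p)" and Z: "integrable M (\<lambda>\<omega>. \<bar>Z \<omega>\<bar> powr p)"
  shows "Lp_norm M p (\<lambda>\<omega>. Y \<omega> + Z \<omega>) \<le> Lp_norm M p Y + Lp_norm M p Z"
proof (rule field_le_epsilon)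
  fix e :: real assume e: "e > 0"
  \<comment> \<open>The added \<open>e / 2\<close> keeps the divisor positive even if the norm
    vanishes.\<close>
  define a where "a = Lp_norm M p Y + e / 2"
  define b where "b = Lp_norm M p Z + e / 2"
  have ab: "a > 0" "b > 0" using e by (auto simp: a_def b_def Lp_norm_nonneg add_nonneg_pos)
  have IY: "(\<integral>\<omega>. \<bar>Y \<omega>\<bar> powr p \<partial>M) \<le> a powr p"
    unfolding Lp_norm_powr[OF p, symmetric] using p e by (intro powr_mono2) (auto simp: a_def Lp_norm_nonneg)
  have IZ: "(\<integral>\<omega>. \<bar>Z \<omega>\<bar> powr p \<partial>M) \<le> b powr p"
    unfolding Lp_norm_powr[OF p, symmetric] using p e by (intro powr_mono2) (auto simp: b_def Lp_norm_nonneg)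
  define u where "u = a / (a + b)"
  define w where "w = b / (a + b)"
  have uw: "u \<ge> 0" "w \<ge> 0" "u + w = 1" using ab by (auto simp: u_def w_def simp flip: add_divide_distrib)
  have pw: "\<bar>Y \<omega> + Z \<omega>\<bar> powr p \<le> (a + b) powr p * (u * (\<bar>Y \<omega>\<bar> powr p / a powr p) + w * (\<bar>Z \<omega>\<bar> powr p / b powr p))" for \<omega>
  proof -
    have "Y \<omega> + Z \<omega> = (a + b) * (u * (Y \<omega> / a) + w * (Z \<omega> / b))"
    proof -
      have "(a + b) * u = a" "(a + b) * w = b" using ab by (auto simp: u_def w_def)
      then have "(a + b) * (u * (Y \<omega> / a) + w * (Z \<omega> / b)) = a * (Y \<omega> / a) + b * (Z \<omega> / b)"
        by (simp only: distrib_left mult.assoc[symmetric])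
      then show ?thesis using ab by simp
    qed
    then have "\<bar>Y \<omega> + Z \<omega>\<bar> powr p = (a + b) powr p * \<bar>u * (Y \<omega> / a) + w * (Z \<omega> / b)\<bar> powr p"
      using ab by (simp add: abs_mult powr_mult)
    also have "\<dots> \<le> (a + b) powr p * (u * \<bar>Y \<omega> / a\<bar> powr p + w * \<bar>Z \<omega> / b\<bar> powr p)"
      by (intro mult_left_mono convex_abs_powr p uw) auto
    finally show ?thesis using ab by (simp add: powr_divide)
  qed
  have "(\<integral>\<omega>. \<bar>Y \<omega> + Z \<omega>\<bar> powr p \<partial>M) \<le> (\<integral>\<omega>. (a + b) powr p * (u * (\<bar>Y \<omega>\<bar> powr p / a powr p) + w * (\<bar>Z \<omega>\<bar> powr p / b powr p)) \<partial>M)"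
    using Y Z integrable_abs_powr_add[OF p _ _ Y Z] pw by (intro integral_mono) auto
  also have "\<dots> = (a + b) powr p * (u * ((\<integral>\<omega>. \<bar>Y \<omega>\<bar> powr p \<partial>M) / a powr p) + w * ((\<integral>\<omega>. \<bar>Z \<omega>\<bar> powr p \<partial>M) / b powr p))"
    using Y Z by simp
  also have "\<dots> \<le> (a + b) powr p * (u * 1 + w * 1)"
    using IY IZ ab uw by (intro mult_left_mono add_mono) (auto simp: divide_le_eq)
  finally have "(\<integral>\<omega>. \<bar>Y \<omega> + Z \<omega>\<bar> powr p \<partial>M) \<le> (a + b) powr p" using uw by simp
  then have "Lp_norm M p (\<lambda>\<omega>. Y \<omega> + Z \<omega>) \<le> a + b"
    unfolding Lp_norm_def using p ab by (intro powr_inverse_exponent_mono) auto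
  then show "Lp_norm M p (\<lambda>\<omega>. Y \<omega> + Z \<omega>) \<le> Lp_norm M p Y + Lp_norm M p Z + e"
    by (simp add: a_def b_def)
qed

lemma Lp_norm_diff_le:
  fixes Y Z :: "'a \<Rightarrow> real"
  assumes p: "p \<ge> 1" and [measurable]: "Y \<in> borel_measurable M" "Z \<in> borel_measurable M"
    and Y: "integrable M (\<lambda>\<omega>. \<bar>Y \<omega>\<bar> powr p)" and Z: "integrable M (\<lambda>\<omega>. \<bar>Z \<omega>\<bar> powr p)"
  shows "\<bar>Lp_norm M p (\<lambda>\<omega>. Y \<omega> + Z \<omega>) - Lp_norm M p Y\<bar> \<le> Lp_norm M p Z"
proof -
  have neg: "integrable M (\<lambda>\<omega>. \<bar>- Z \<omega>\<bar> powr p)" using Z by simp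
  have "Lp_norm M p (\<lambda>\<omega>. (Y \<omega> + Z \<omega>) + - Z \<omega>) \<le> Lp_norm M p (\<lambda>\<omega>. Y \<omega> + Z \<omega>) + Lp_norm M p (\<lambda>\<omega>. - Z \<omega>)"
    by (intro Lp_norm_triangle p neg integrable_abs_powr_add Y Z) measurable
  moreover have "Lp_norm M p (\<lambda>\<omega>. - Z \<omega>) = Lp_norm M p Z" by (simp add: Lp_norm_def)
  ultimately show ?thesis
    using Lp_norm_triangle[OF p _ _ Y Z] by simp
qed

section \<open>Moments as extended nonnegative integrals, before finiteness is known\<close>

lemma nn_integral_abs_powr_finite_iff:
  fixes Y :: "'a \<Rightarrow> real"
  assumes [measurable]: "Y \<in> borel_measurable M"
  shows "integrable M (\<lambda>\<omega>. \<bar>Y \<omega>\<bar> powr p) \<longleftrightarrow> (\<integral>\<^sup>+\<omega>. ennreal (\<bar>Y \<omega>\<bar> powr p) \<partial>M) < \<top>"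
  by (simp add: integrable_iff_bounded)

lemma nn_integral_abs_powr_add_le:
  fixes Y Z :: "'a \<Rightarrow> real"
  assumes p: "p \<ge> 1" and [measurable]: "Y \<in> borel_measurable M" "Z \<in> borel_measurable M"
  shows "(\<integral>\<^sup>+\<omega>. ennreal (\<bar>Y \<omega> + Z \<omega>\<bar> powr p) \<partial>M) \<le>
    ennreal (2 powr p) * ((\<integral>\<^sup>+\<omega>. ennreal (\<bar>Y \<omega>\<bar> powr p) \<partial>M) + (\<integral>\<^sup>+\<omega>. ennreal (\<bar>Z \<omega>\<bar> powr p) \<partial>M))"
proof -
  have "(\<integral>\<^sup>+\<omega>. ennreal (\<bar>Y \<omega> + Z \<omega>\<bar> powr p) \<partial>M) \<le>
      (\<integral>\<^sup>+\<omega>. ennreal (2 powr p) * (ennreal (\<bar>Y \<omega>\<bar> powr p) + ennreal (\<bar>Z \<omega>\<bar> powr p)) \<partial>M)"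
    using abs_add_powr_le[OF p]
    by (intro nn_integral_mono) (simp add: ennreal_mult'[symmetric] ennreal_leI flip: ennreal_plus)
  also have "\<dots> = ennreal (2 powr p) * ((\<integral>\<^sup>+\<omega>. ennreal (\<bar>Y \<omega>\<bar> powr p) \<partial>M) + (\<integral>\<^sup>+\<omega>. ennreal (\<bar>Z \<omega>\<bar> powr p) \<partial>M))"
    by (simp add: nn_integral_cmult nn_integral_add)
  finally show ?thesis .
qed

lemma nn_integral_abs_powr_cmult:
  fixes Y :: "'a \<Rightarrow> real"
  assumes [measurable]: "Y \<in> borel_measurable M"
  shows "(\<integral>\<^sup>+\<omega>. ennreal (\<bar>c * Y \<omega>\<bar> powr p) \<partial>M) = ennreal (\<bar>c\<bar> powr p) * (\<integral>\<^sup>+\<omega>. ennreal (\<bar>Y \<omega>\<bar> powr p) \<partial>M)"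
  by (simp add: abs_mult powr_mult ennreal_mult' nn_integral_cmult)

text \<open>With \<open>phi x = min |x| n powr p\<close> the truncated moments satisfy
  \<open>E phi(Y) = E phi(Y') \<le> E phi(r Y) + E phi(C (Y' - c Y))\<close> for some \<open>r < 1\<close>, and
  \<open>phi(Y) - phi(r Y)\<close> dominates \<open>(1 - r powr p) |Y| powr p\<close> where \<open>|Y| \<le> n\<close>; then let \<open>n \<rightarrow> \<infinity>\<close>.\<close>

lemma (in prob_space) integrable_of_affine_recursion:
  fixes Y Y' :: "'a \<Rightarrow> real"
  assumes [measurable]: "Y \<in> borel_measurable M" "Y' \<in> borel_measurable M"
    and eq: "\<And>f :: real \<Rightarrow> real. f \<in> borel_measurable borel \<Longrightarrow> (\<integral>\<omega>. f (Y' \<omega>) \<partial>M) = (\<integral>\<omega>. f (Y \<omega>) \<partial>M)"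
    and c: "0 < c" "c < 1" and p: "p \<ge> 1"
    and W: "integrable M (\<lambda>\<omega>. \<bar>Y' \<omega> - c * Y \<omega>\<bar> powr p)"
  shows "integrable M (\<lambda>\<omega>. \<bar>Y \<omega>\<bar> powr p)"
proof -
  \<comment> \<open>Any \<open>q\<close> strictly between \<open>c\<close> and 1 would do. If
    \<open>|Y'|\<close> exceeds \<open>r * |Y|\<close>, then \<open>c * |Y|\<close> is at most
    \<open>q * |Y'|\<close>, so \<open>Y' - c * Y\<close> has size at least
    \<open>(1 - q) * |Y'|\<close>; this explains \<open>r\<close> and \<open>C\<close>.\<close>
  define q where "q = (1 + c) / 2"
  define r where "r = c / q"
  define C where "C = 1 / (1 - q)"
  have q: "0 < q" "q < 1" "c < q" using c by (auto simp: q_def)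
  have r: "0 < r" "r < 1" and C: "C > 0" using q c by (auto simp: r_def C_def)
  have rp: "r powr p < 1" using powr_less_mono2[of p r 1] r p by simp
  define D where "D = (\<integral>\<omega>. \<bar>C * (Y' \<omega> - c * Y \<omega>)\<bar> powr p \<partial>M) / (1 - r powr p)"
  have bound: "(\<integral>\<omega>. \<bar>Y \<omega>\<bar> powr p * indicator {..real n} \<bar>Y \<omega>\<bar> \<partial>M) \<le> D" for n :: nat
  proof -
    define phi where "phi x = min \<bar>x\<bar> (real n) powr p" for x :: real
    have [measurable]: "phi \<in> borel_measurable borel" unfolding phi_def by measurable
    have phi_bd: "\<bar>phi x\<bar> \<le> real n powr p" for x
      using p by (auto simp: phi_def intro!: powr_mono2)
    have phi_int: "integrable M (\<lambda>\<omega>. phi (V \<omega>))" if [measurable]: "V \<in> borel_measurable M" for V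
      using phi_bd by (intro integrable_const_bound[where B="real n powr p"]) auto
    have ind_int: "integrable M (\<lambda>\<omega>. \<bar>Y \<omega>\<bar> powr p * indicator {..real n} \<bar>Y \<omega>\<bar>)"
      using p by (intro integrable_const_bound[where B="real n powr p"]) (auto simp: indicator_def intro!: powr_mono2)
    have phi_mono: "phi x \<le> phi y" if "\<bar>x\<bar> \<le> \<bar>y\<bar>" for x y
      using that p by (auto simp: phi_def intro!: powr_mono2)
    have phi_split: "phi (Y' \<omega>) \<le> phi (r * Y \<omega>) + phi (C * (Y' \<omega> - c * Y \<omega>))" for \<omega>
    proof (cases "\<bar>Y' \<omega>\<bar> \<le> \<bar>r * Y \<omega>\<bar>")
      case True
      then show ?thesis using phi_mono[OF True] by (simp add: phi_def add_increasing2)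
    next
      case False
      have "c * \<bar>Y \<omega>\<bar> = q * \<bar>r * Y \<omega>\<bar>" using r q c by (simp add: r_def abs_mult)
      also have "\<dots> \<le> q * \<bar>Y' \<omega>\<bar>" using False q by (intro mult_left_mono) auto
      finally have "\<bar>Y' \<omega>\<bar> - q * \<bar>Y' \<omega>\<bar> \<le> \<bar>Y' \<omega>\<bar> - \<bar>c * Y \<omega>\<bar>" using c by (simp add: abs_mult)
      also have "\<dots> \<le> \<bar>Y' \<omega> - c * Y \<omega>\<bar>" by linarith
      finally have "(1 - q) * \<bar>Y' \<omega>\<bar> \<le> \<bar>Y' \<omega> - c * Y \<omega>\<bar>" by (simp add: algebra_simps)
      then have "\<bar>Y' \<omega>\<bar> \<le> \<bar>C * (Y' \<omega> - c * Y \<omega>)\<bar>"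
        using q by (simp add: C_def abs_mult pos_le_divide_eq mult.commute)
      from phi_mono[OF this] show ?thesis by (simp add: phi_def add_increasing)
    qed
    have phi_gap: "(1 - r powr p) * (\<bar>Y \<omega>\<bar> powr p * indicator {..real n} \<bar>Y \<omega>\<bar>) \<le> phi (Y \<omega>) - phi (r * Y \<omega>)" for \<omega>
    proof (cases "\<bar>Y \<omega>\<bar> \<le> real n")
      case True
      have "r * \<bar>Y \<omega>\<bar> \<le> 1 * \<bar>Y \<omega>\<bar>" using r by (intro mult_right_mono) auto
      then have "r * \<bar>Y \<omega>\<bar> \<le> real n" using True by simp
      then show ?thesis using True r
        by (simp add: phi_def abs_mult powr_mult algebra_simps min_absorb1)
    next
      case False
      have "phi (r * Y \<omega>) \<le> phi (Y \<omega>)"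
        using r by (intro phi_mono) (simp add: abs_mult mult_left_le_one_le)
      then show ?thesis using False by simp
    qed
    have "(1 - r powr p) * (\<integral>\<omega>. \<bar>Y \<omega>\<bar> powr p * indicator {..real n} \<bar>Y \<omega>\<bar> \<partial>M)
        = (\<integral>\<omega>. (1 - r powr p) * (\<bar>Y \<omega>\<bar> powr p * indicator {..real n} \<bar>Y \<omega>\<bar>) \<partial>M)" by simp
    also have "\<dots> \<le> (\<integral>\<omega>. phi (Y \<omega>) - phi (r * Y \<omega>) \<partial>M)"
      using ind_int phi_gap by (intro integral_mono integrable_mult_right Bochner_Integration.integrable_diff phi_int) auto
    \<comment> \<open>Equality in law enters here. The truncation makes all these integrals finite,
      so the subtraction is legitimate although the moments of \<open>Y\<close> are still
      unknown.\<close>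
    also have "\<dots> = (\<integral>\<omega>. phi (Y' \<omega>) \<partial>M) - (\<integral>\<omega>. phi (r * Y \<omega>) \<partial>M)"
      by (subst Bochner_Integration.integral_diff) (auto intro!: phi_int simp: eq)
    also have "\<dots> = (\<integral>\<omega>. phi (Y' \<omega>) - phi (r * Y \<omega>) \<partial>M)"
      by (subst Bochner_Integration.integral_diff) (auto intro!: phi_int)
    also have "\<dots> \<le> (\<integral>\<omega>. \<bar>C * (Y' \<omega> - c * Y \<omega>)\<bar> powr p \<partial>M)"
    proof (intro integral_mono Bochner_Integration.integrable_diff phi_int)
      show "integrable M (\<lambda>\<omega>. \<bar>C * (Y' \<omega> - c * Y \<omega>)\<bar> powr p)"
        using W by (simp add: abs_mult powr_mult)
      fix \<omega>
      have "phi (C * (Y' \<omega> - c * Y \<omega>)) \<le> \<bar>C * (Y' \<omega> - c * Y \<omega>)\<bar> powr p"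
        using p by (auto simp: phi_def intro!: powr_mono2)
      then show "phi (Y' \<omega>) - phi (r * Y \<omega>) \<le> \<bar>C * (Y' \<omega> - c * Y \<omega>)\<bar> powr p"
        using phi_split[of \<omega>] by simp
    qed measurable
    finally show ?thesis using rp by (simp add: D_def pos_le_divide_eq mult.commute)
  qed
  \<comment> \<open>The constant \<open>D\<close> does not depend on \<open>n\<close>, so Fatou's
    lemma removes the truncation.\<close>
  have "(\<integral>\<^sup>+\<omega>. ennreal (\<bar>Y \<omega>\<bar> powr p) \<partial>M) =
      (\<integral>\<^sup>+\<omega>. liminf (\<lambda>n. ennreal (\<bar>Y \<omega>\<bar> powr p * indicator {..real n} \<bar>Y \<omega>\<bar>)) \<partial>M)"
  proof (intro nn_integral_cong)
    fix \<omega>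
    have "eventually (\<lambda>n. real n \<ge> \<bar>Y \<omega>\<bar>) sequentially"
      by real_asymp
    then have "eventually (\<lambda>n. ennreal (\<bar>Y \<omega>\<bar> powr p * indicator {..real n} \<bar>Y \<omega>\<bar>) = ennreal (\<bar>Y \<omega>\<bar> powr p)) sequentially"
      by eventually_elim simp
    then have "(\<lambda>n. ennreal (\<bar>Y \<omega>\<bar> powr p * indicator {..real n} \<bar>Y \<omega>\<bar>)) \<longlonglongrightarrow> ennreal (\<bar>Y \<omega>\<bar> powr p)"
      by (rule tendsto_eventually)
    then show "ennreal (\<bar>Y \<omega>\<bar> powr p) = liminf (\<lambda>n. ennreal (\<bar>Y \<omega>\<bar> powr p * indicator {..real n} \<bar>Y \<omega>\<bar>))"
      by (rule lim_imp_Liminf[OF sequentially_bot, symmetric])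
  qed
  also have "\<dots> \<le> liminf (\<lambda>n. \<integral>\<^sup>+\<omega>. ennreal (\<bar>Y \<omega>\<bar> powr p * indicator {..real n} \<bar>Y \<omega>\<bar>) \<partial>M)"
    by (rule nn_integral_liminf) measurable
  also have "\<dots> \<le> ennreal D"
  proof (rule Liminf_le)
    have "(\<integral>\<^sup>+\<omega>. ennreal (\<bar>Y \<omega>\<bar> powr p * indicator {..real n} \<bar>Y \<omega>\<bar>) \<partial>M) \<le> ennreal D" for n
    proof -
      have "integrable M (\<lambda>\<omega>. \<bar>Y \<omega>\<bar> powr p * indicator {..real n} \<bar>Y \<omega>\<bar>)"
        using p by (intro integrable_const_bound[where B="real n powr p"]) (auto simp: indicator_def intro!: powr_mono2)
      then show ?thesis using bound[of n] by (subst nn_integral_eq_integral) (auto intro!: ennreal_leI)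
    qed
    then show "\<forall>\<^sub>F n in sequentially. (\<integral>\<^sup>+\<omega>. ennreal (\<bar>Y \<omega>\<bar> powr p * indicator {..real n} \<bar>Y \<omega>\<bar>) \<partial>M) \<le> ennreal D"
      by simp
  qed simp
  also have "\<dots> < \<top>" by simp
  finally show ?thesis by (simp add: nn_integral_abs_powr_finite_iff)
qed

text \<open>Apply Jensen's inequality path by path and exchange the integrals by Tonelli; the length
  of the interval supplies the last factor \<open>t\<close> in \<open>t powr p\<close>.\<close>

lemma (in prob_space) moment_integral_le:
  fixes Z :: "real \<Rightarrow> 'a \<Rightarrow> real"
  assumes [measurable]: "case_prod Z \<in> borel_measurable (borel \<Otimes>\<^sub>M M)"
    and p: "p \<ge> 1" and t: "t \<ge> 0"
    and m: "\<And>s. s \<in> {0..t} \<Longrightarrow> (\<integral>\<^sup>+\<omega>. ennreal (\<bar>Z s \<omega>\<bar> powr p) \<partial>M) \<le> m"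
  shows "(\<integral>\<^sup>+\<omega>. ennreal (\<bar>LINT s:{0..t}|lborel. Z s \<omega>\<bar> powr p) \<partial>M) \<le> ennreal (t powr p) * m"
proof -
  interpret L: pair_sigma_finite lborel M ..
  have "(\<integral>\<^sup>+\<omega>. ennreal (\<bar>LINT s:{0..t}|lborel. Z s \<omega>\<bar> powr p) \<partial>M)
      \<le> (\<integral>\<^sup>+\<omega>. ennreal (t powr (p - 1)) * (\<integral>\<^sup>+s\<in>{0..t}. ennreal (\<bar>Z s \<omega>\<bar> powr p) \<partial>lborel) \<partial>M)"
    using p t by (intro nn_integral_mono integral_abs_powr_le) auto
  also have "\<dots> = ennreal (t powr (p - 1)) * (\<integral>\<^sup>+\<omega>. (\<integral>\<^sup>+s. ennreal (\<bar>Z s \<omega>\<bar> powr p) * indicator {0..t} s \<partial>lborel) \<partial>M)"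
    by (rule nn_integral_cmult) measurable
  also have "(\<integral>\<^sup>+\<omega>. (\<integral>\<^sup>+s. ennreal (\<bar>Z s \<omega>\<bar> powr p) * indicator {0..t} s \<partial>lborel) \<partial>M) =
      (\<integral>\<^sup>+s. (\<integral>\<^sup>+\<omega>. ennreal (\<bar>Z s \<omega>\<bar> powr p) * indicator {0..t} s \<partial>M) \<partial>lborel)"
    by (rule L.Fubini') measurable
  also have "\<dots> \<le> (\<integral>\<^sup>+s. m * indicator {0..t} s \<partial>lborel)"
    using m by (intro nn_integral_mono) (auto simp: indicator_def)
  also have "\<dots> = m * ennreal t"
    using t by (simp add: nn_integral_cmult_indicator)
  also have "ennreal (t powr (p - 1)) * (m * ennreal t) = ennreal (t powr p) * m"
  proof -
    have "t powr (p - 1) * t = t powr p"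
      using powr_add[of t "p - 1" 1] t p by (cases "t = 0") auto
    then have "ennreal (t powr (p - 1)) * ennreal t = ennreal (t powr p)"
      using t by (simp flip: ennreal_mult')
    then show ?thesis by (simp add: ac_simps)
  qed
  finally show ?thesis by (simp add: mult_left_mono)
qed

subsection \<open>Quasi Ornstein-Uhlenbeck processes: moments and increments\<close>

text \<open>Off a set of small measure \<open>h\<close> is at most some \<open>n\<close>; then for every \<open>t \<in> [0, 1]\<close> some \<open>s\<close> makes both
  \<open>h s\<close> and \<open>h (s - t)\<close> at most \<open>n\<close>.\<close>

lemma locally_bounded_of_subadditive:
  fixes h :: "real \<Rightarrow> ennreal"
  assumes [measurable]: "h \<in> borel_measurable borel"
    and fin: "\<And>s. h s < \<top>"
    and sub: "\<And>s t. h t \<le> C * (h s + h (s - t))" and C: "C < \<top>"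
  shows "\<exists>B<\<top>. \<forall>t\<in>{0..1}. h t \<le> B"
proof -
  \<comment> \<open>The interval \<open>{-1..1}\<close> contains \<open>s\<close> and
    \<open>s - t\<close> for all \<open>s\<close> and \<open>t\<close> in \<open>{0..1}\<close>.
    These sets decrease to the empty set because \<open>h\<close> is finite, so their measures tend
    to 0.\<close>
  define E where "E n = {s \<in> {-1..1}. of_nat n < h s}" for n :: nat
  have E [measurable]: "E n \<in> sets borel" for n unfolding E_def by measurable
  have "(\<lambda>n. emeasure lborel (E n)) \<longlonglongrightarrow> emeasure lborel (\<Inter>n. E n)"
  proof (rule Lim_emeasure_decseq)
    show "decseq E"
      unfolding E_def decseq_def by (auto intro: le_less_trans[rotated] simp: of_nat_mono)
    fix n
    have "emeasure lborel (E n) \<le> emeasure lborel {-1..1::real}"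
      by (intro emeasure_mono) (auto simp: E_def)
    then show "emeasure lborel (E n) \<noteq> \<infinity>" by (auto simp: top_unique)
  qed auto
  moreover have "(\<Inter>n. E n) = {}"
  proof (intro equals0I)
    fix s assume s: "s \<in> (\<Inter>n. E n)"
    obtain n :: nat where "h s < of_nat n" using fin[of s] ennreal_Ex_less_of_nat by (auto simp: less_top)
    moreover have "of_nat n < h s" using s by (auto simp: E_def)
    ultimately show False by (auto dest: less_trans)
  qed
  ultimately have "(\<lambda>n. emeasure lborel (E n)) \<longlonglongrightarrow> 0" by simp
  then have "eventually (\<lambda>n. emeasure lborel (E n) < ennreal (1 / 2)) sequentially"
    by (rule order_tendstoD) (subst ennreal_less_zero_iff, simp)
  then obtain n where n: "emeasure lborel (E n) < ennreal (1 / 2)"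
    by (auto simp: eventually_sequentially)
  have "h t \<le> C * (of_nat n + of_nat n)" if t: "t \<in> {0..1}" for t
  proof -
    have vm: "(\<lambda>s. - t + s) -` E n \<in> sets borel"
      by (rule measurable_sets_borel[OF _ E]) measurable
    \<comment> \<open>Otherwise an interval of length 1 would be covered by \<open>E n\<close> and a
      translate of it, each of measure below \<open>1 / 2\<close>.\<close>
    have "\<not> {0..1} \<subseteq> E n \<union> (\<lambda>s. - t + s) -` E n"
    proof
      assume "{0..1} \<subseteq> E n \<union> (\<lambda>s. - t + s) -` E n"
      then have "emeasure lborel {0..1::real} \<le> emeasure lborel (E n \<union> (\<lambda>s. - t + s) -` E n)"
        using vm E by (intro emeasure_mono) auto
      also have "\<dots> \<le> emeasure lborel (E n) + emeasure lborel ((\<lambda>s. - t + s) -` E n)"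
        using vm E by (intro emeasure_subadditive) auto
      also have "emeasure lborel ((\<lambda>s. - t + s) -` E n) = emeasure (distr lborel borel (\<lambda>s. - t + s)) (E n)"
        by (simp add: emeasure_distr)
      also have "\<dots> = emeasure lborel (E n)"
        by (subst lborel_distr_plus) (rule refl)
      also have "emeasure lborel (E n) + emeasure lborel (E n) < ennreal (1 / 2) + ennreal (1 / 2)"
        by (intro add_strict_mono n)
      also have "\<dots> = 1" by (subst ennreal_plus[symmetric]) simp_all
      finally show False by simp
    qed
    then obtain s where "s \<in> {0..1}" "s \<notin> E n" "- t + s \<notin> E n" by blast
    then have s: "s \<in> {0..1}" "s \<notin> E n" "s - t \<notin> E n" by auto
    then have "h s \<le> of_nat n" "h (s - t) \<le> of_nat n" using t by (auto simp: E_def not_less)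
    then show ?thesis using sub[of t s] by (meson add_mono mult_left_mono order_trans zero_le)
  qed
  moreover have "C * (of_nat n + of_nat n) < \<top>" using C by (simp add: ennreal_mult_less_top of_nat_less_top)
  ultimately show ?thesis by blast
qed

section \<open>Transfer of expectations along equal finite-dimensional distributions\<close>

lemma same_fdd_distr_pair:
  assumes "same_fdd M Y Z"
    and [measurable]: "\<And>t. Y t \<in> borel_measurable M" "\<And>t. Z t \<in> borel_measurable M"
  shows "distr M (borel \<Otimes>\<^sub>M borel) (\<lambda>\<omega>. (Y s \<omega>, Y t \<omega>)) =
    distr M (borel \<Otimes>\<^sub>M borel) (\<lambda>\<omega>. (Z s \<omega>, Z t \<omega>))"
proof -
  \<comment> \<open>For \<open>s = t\<close> the index set has one element and the projection
    duplicates the coordinate, so single times are covered too.\<close>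
  let ?P = "\<Pi>\<^sub>M u\<in>{s, t}. (borel :: real measure)"
  have eq: "distr M ?P (\<lambda>\<omega>. \<lambda>u\<in>{s, t}. Y u \<omega>) = distr M ?P (\<lambda>\<omega>. \<lambda>u\<in>{s, t}. Z u \<omega>)"
    using assms(1) by (auto simp: same_fdd_def)
  have proj [measurable]: "(\<lambda>f. (f s, f t)) \<in> measurable ?P (borel \<Otimes>\<^sub>M borel)"
    by (intro measurable_Pair measurable_component_singleton) auto
  have "distr M (borel \<Otimes>\<^sub>M borel) (\<lambda>\<omega>. (V s \<omega>, V t \<omega>)) =
      distr (distr M ?P (\<lambda>\<omega>. \<lambda>u\<in>{s, t}. V u \<omega>)) (borel \<Otimes>\<^sub>M borel) (\<lambda>f. (f s, f t))"
    if [measurable]: "\<And>t. V t \<in> borel_measurable M" for V :: "real \<Rightarrow> 'a \<Rightarrow> real"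
    by (subst distr_distr) (auto simp: comp_def)
  then show ?thesis using eq by simp
qed

lemma same_fdd_nn_integral:
  fixes f :: "real \<times> real \<Rightarrow> ennreal"
  assumes "same_fdd M Y Z"
    and [measurable]: "\<And>t. Y t \<in> borel_measurable M" "\<And>t. Z t \<in> borel_measurable M"
    and [measurable]: "f \<in> borel_measurable (borel \<Otimes>\<^sub>M borel)"
  shows "(\<integral>\<^sup>+\<omega>. f (Y s \<omega>, Y t \<omega>) \<partial>M) = (\<integral>\<^sup>+\<omega>. f (Z s \<omega>, Z t \<omega>) \<partial>M)"
  using arg_cong[OF same_fdd_distr_pair[OF assms(1-3), of s t], of "\<lambda>D. \<integral>\<^sup>+z. f z \<partial>D"]
  by (simp add: nn_integral_distr)

lemma same_fdd_integral:
  fixes f :: "real \<times> real \<Rightarrow> real"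
  assumes "same_fdd M Y Z"
    and [measurable]: "\<And>t. Y t \<in> borel_measurable M" "\<And>t. Z t \<in> borel_measurable M"
    and [measurable]: "f \<in> borel_measurable (borel \<Otimes>\<^sub>M borel)"
  shows "(\<integral>\<omega>. f (Y s \<omega>, Y t \<omega>) \<partial>M) = (\<integral>\<omega>. f (Z s \<omega>, Z t \<omega>) \<partial>M)"
  using arg_cong[OF same_fdd_distr_pair[OF assms(1-3), of s t], of "\<lambda>D. \<integral>z. f z \<partial>D"]
  by (simp add: integral_distr)

text \<open>Second moments are deferred to \<open>qou_square_integrable\<close>, so that the moment
  results here can be stated for a general exponent \<open>p\<close>.\<close>

locale qou = prob_space M for M :: "'a measure" +
  fixes N X :: "real \<Rightarrow> 'a \<Rightarrow> real" and lam :: real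
  assumes N_measurable: "measurable_process M N"
    and N_increments: "stationary_increments M N"
    and N_0: "AE \<omega> in M. N 0 \<omega> = 0"
    and lam_pos: "lam > 0"
    and qou_process: "QOU_process M lam N X"
begin

sublocale L: pair_sigma_finite lborel M ..

lemma N_joint [measurable]: "case_prod N \<in> borel_measurable (borel \<Otimes>\<^sub>M M)"
  using N_measurable by (simp add: measurable_process_def)

lemma N_comp [measurable (raw)]:
  assumes [measurable]: "f \<in> borel_measurable A" "g \<in> measurable A M"
  shows "(\<lambda>x. N (f x) (g x)) \<in> borel_measurable A"
  using measurable_compose[OF measurable_Pair[OF assms] N_joint] by simp

lemma X_rv [measurable]: "X t \<in> borel_measurable M"
  using qou_process by (simp add: QOU_process_def stationary_process_def)

lemma X_shift: "same_fdd M X (\<lambda>t. X (t + s))"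
  using qou_process by (simp add: QOU_process_def stationary_process_def)

lemma X_integral_shift:
  fixes f :: "real \<times> real \<Rightarrow> real"
  assumes "f \<in> borel_measurable (borel \<Otimes>\<^sub>M borel)"
  shows "(\<integral>\<omega>. f (X (s + h) \<omega>, X (t + h) \<omega>) \<partial>M) = (\<integral>\<omega>. f (X s \<omega>, X t \<omega>) \<partial>M)"
  using same_fdd_integral[OF X_shift[of h] X_rv X_rv assms, of s t] by simp

lemma X_integral_eq:
  fixes f :: "real \<Rightarrow> real"
  assumes [measurable]: "f \<in> borel_measurable borel"
  shows "(\<integral>\<omega>. f (X t \<omega>) \<partial>M) = (\<integral>\<omega>. f (X 0 \<omega>) \<partial>M)"
  using X_integral_shift[of "\<lambda>z. f (fst z)" 0 t 0] by simp

lemma X_nn_integral_eq: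
  fixes f :: "real \<Rightarrow> ennreal"
  assumes [measurable]: "f \<in> borel_measurable borel"
  shows "(\<integral>\<^sup>+\<omega>. f (X t \<omega>) \<partial>M) = (\<integral>\<^sup>+\<omega>. f (X 0 \<omega>) \<partial>M)"
  using same_fdd_nn_integral[OF X_shift[of t] X_rv X_rv, of "\<lambda>z. f (fst z)" 0 0] by simp

lemma N_nn_integral_increment:
  fixes f :: "real \<Rightarrow> ennreal"
  assumes [measurable]: "f \<in> borel_measurable borel"
  shows "(\<integral>\<^sup>+\<omega>. f (N s \<omega> - N t \<omega>) \<partial>M) = (\<integral>\<^sup>+\<omega>. f (N (s - t) \<omega>) \<partial>M)"
proof -
  have "same_fdd M (\<lambda>u \<omega>. N u \<omega> - N 0 \<omega>) (\<lambda>u \<omega>. N (u + t) \<omega> - N t \<omega>)"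
    using N_increments by (simp add: stationary_increments_def)
  from same_fdd_nn_integral[OF this, of "\<lambda>z. f (fst z)" "s - t" "s - t"]
  have "(\<integral>\<^sup>+\<omega>. f (N s \<omega> - N t \<omega>) \<partial>M) = (\<integral>\<^sup>+\<omega>. f (N (s - t) \<omega> - N 0 \<omega>) \<partial>M)" by simp
  also have "\<dots> = (\<integral>\<^sup>+\<omega>. f (N (s - t) \<omega>) \<partial>M)"
    using N_0 by (intro nn_integral_cong_AE) auto
  finally show ?thesis .
qed

lemma N_integral_increment:
  fixes f :: "real \<Rightarrow> real"
  assumes [measurable]: "f \<in> borel_measurable borel"
  shows "(\<integral>\<omega>. f (N s \<omega> - N t \<omega>) \<partial>M) = (\<integral>\<omega>. f (N (s - t) \<omega>) \<partial>M)"
proof -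
  have "same_fdd M (\<lambda>u \<omega>. N u \<omega> - N 0 \<omega>) (\<lambda>u \<omega>. N (u + t) \<omega> - N t \<omega>)"
    using N_increments by (simp add: stationary_increments_def)
  from same_fdd_integral[OF this, of "\<lambda>z. f (fst z)" "s - t" "s - t"]
  have "(\<integral>\<omega>. f (N s \<omega> - N t \<omega>) \<partial>M) = (\<integral>\<omega>. f (N (s - t) \<omega> - N 0 \<omega>) \<partial>M)" by simp
  also have "\<dots> = (\<integral>\<omega>. f (N (s - t) \<omega>) \<partial>M)"
    using N_0 by (intro integral_cong_AE) auto
  finally show ?thesis .
qed

text \<open>Up to a null set \<open>- N t\<close> is the increment of \<open>N\<close> from time
  \<open>t\<close> to time 0. This carries results for positive times over to negative ones.\<close>

lemma N_integral_minus:
  fixes f :: "real \<Rightarrow> real"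
  assumes [measurable]: "f \<in> borel_measurable borel"
  shows "(\<integral>\<omega>. f (N (- t) \<omega>) \<partial>M) = (\<integral>\<omega>. f (- N t \<omega>) \<partial>M)"
proof -
  have "(\<integral>\<omega>. f (N (- t) \<omega>) \<partial>M) = (\<integral>\<omega>. f (N 0 \<omega> - N t \<omega>) \<partial>M)"
    using N_integral_increment[of f 0 t] by simp
  also have "\<dots> = (\<integral>\<omega>. f (- N t \<omega>) \<partial>M)"
    using N_0 by (intro integral_cong_AE) auto
  finally show ?thesis .
qed

text \<open>Write \<open>N t = N s - (N s - N t)\<close>; the increment has the law of
  \<open>N (s - t)\<close>. Hence the moment function is subadditive up to the factor
  \<open>2 powr p\<close>, and it is Borel by joint measurability.\<close>

lemma N_moment_locally_bounded:
  assumes p: "p \<ge> 1" and fin: "finite_moments M p N"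
  shows "\<exists>B<\<top>. \<forall>t\<in>{0..1}. (\<integral>\<^sup>+\<omega>. ennreal (\<bar>N t \<omega>\<bar> powr p) \<partial>M) \<le> B"
proof (rule locally_bounded_of_subadditive[where C="ennreal (2 powr p)"])
  show "(\<lambda>t. \<integral>\<^sup>+\<omega>. ennreal (\<bar>N t \<omega>\<bar> powr p) \<partial>M) \<in> borel_measurable borel"
    by measurable
  show "(\<integral>\<^sup>+\<omega>. ennreal (\<bar>N s \<omega>\<bar> powr p) \<partial>M) < \<top>" for s
    using fin by (simp add: finite_moments_def nn_integral_abs_powr_finite_iff[symmetric])
  show "(\<integral>\<^sup>+\<omega>. ennreal (\<bar>N t \<omega>\<bar> powr p) \<partial>M) \<le> ennreal (2 powr p) *
      ((\<integral>\<^sup>+\<omega>. ennreal (\<bar>N s \<omega>\<bar> powr p) \<partial>M) + (\<integral>\<^sup>+\<omega>. ennreal (\<bar>N (s - t) \<omega>\<bar> powr p) \<partial>M))" for s t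
    using nn_integral_abs_powr_add_le[OF p, of "N s" M "\<lambda>\<omega>. - (N s \<omega> - N t \<omega>)"]
      N_nn_integral_increment[of "\<lambda>x. ennreal (\<bar>x\<bar> powr p)" s t]
    by (simp add: abs_minus_commute)
qed simp

text \<open>For \<open>t \<ge> 0\<close> the interval integral is a set integral over
  \<open>{0..t}\<close>, the endpoints being null. Negative times are reached later by
  stationarity.\<close>

lemma qou_path:
  "AE \<omega> in M. \<forall>t\<ge>0. set_integrable lborel {0..t} (\<lambda>s. X s \<omega>) \<and>
     X t \<omega> = X 0 \<omega> - lam * (LINT s:{0..t}|lborel. X s \<omega>) + N t \<omega>"
proof -
  have "AE \<omega> in M. \<forall>t. interval_lebesgue_integrable lborel 0 (ereal t) (\<lambda>s. X s \<omega>) \<and>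
      X t \<omega> = X 0 \<omega> - lam * (LBINT s=0..ereal t. X s \<omega>) + N t \<omega>"
    using qou_process by (simp add: QOU_process_def)
  then show ?thesis
  proof eventually_elim
    case (elim \<omega>)
    show ?case
    proof (intro allI impI conjI)
      fix t :: real assume t: "t \<ge> 0"
      have "set_integrable lborel (einterval (ereal 0) (ereal t)) (\<lambda>s. X s \<omega>)"
        using elim[rule_format, of t] t by (simp add: interval_lebesgue_integrable_def zero_ereal_def)
      then have "set_integrable lborel {0<..<t} (\<lambda>s. X s \<omega>)" by simp
      also have "?this \<longleftrightarrow> set_integrable lborel {0..t} (\<lambda>s. X s \<omega>)"
        unfolding set_integrable_def
        by (rule integrable_discrete_difference[where X="{0, t}"]) (auto simp: indicator_def)
      finally show "set_integrable lborel {0..t} (\<lambda>s. X s \<omega>)" .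
      have "(LBINT s=0..ereal t. X s \<omega>) = (LINT s:{0..t}|lborel. X s \<omega>)"
        using interval_integral_Icc[OF t, of "\<lambda>s. X s \<omega>"] by (simp add: zero_ereal_def)
      then show "X t \<omega> = X 0 \<omega> - lam * (LINT s:{0..t}|lborel. X s \<omega>) + N t \<omega>"
        using elim[rule_format, of t] by simp
    qed
  qed
qed

text \<open>The definition of a QOU process does not ask for joint measurability of \<open>X\<close>; on
  \<open>t \<ge> 0\<close> the explicit solution of the pathwise equation is a jointly measurable version.\<close>

definition X' :: "real \<Rightarrow> 'a \<Rightarrow> real" where
  "X' t \<omega> = N t \<omega> + exp (- lam * t) * X 0 \<omega> - lam * (LINT s:{0..t}|lborel. exp (- lam * (t - s)) * N s \<omega>)"

lemma X'_joint [measurable]: "case_prod X' \<in> borel_measurable (borel \<Otimes>\<^sub>M M)"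
proof -
  \<comment> \<open>Moving the variable domain into the integrand as a condition gives a
    parametrised integral with fixed domain, whose joint measurability is standard.\<close>
  have *: "(LINT s:{0..t}|lborel. exp (- lam * (t - s)) * N s \<omega>) =
      (LINT s|lborel. (if 0 \<le> s \<and> s \<le> t then exp (- lam * (t - s)) * N s \<omega> else 0))" for t \<omega>
    unfolding set_lebesgue_integral_def by (intro Bochner_Integration.integral_cong) auto
  show ?thesis
    unfolding X'_def * by measurable
qed

text \<open>The defining equation holds for all times off a single null set, so the resolvent
  formula does too. This is what allows pathwise integrals of \<open>X\<close> to be replaced by
  those of \<open>X'\<close>.\<close>

lemma X_eq_X': "AE \<omega> in M. \<forall>t\<ge>0. X t \<omega> = X' t \<omega>"
  using qou_path
proof eventually_elim
  case (elim \<omega>)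
  show ?case
  proof (intro allI impI)
    fix t :: real assume t: "t \<ge> 0"
    show "X t \<omega> = X' t \<omega>"
      unfolding X'_def
    proof (rule volterra_solution[OF lam_pos t])
      show "set_integrable lborel {0..t} (\<lambda>s. X s \<omega>)" using elim t by blast
      show "X s \<omega> = X 0 \<omega> - lam * (LINT r:{0..s}|lborel. X r \<omega>) + N s \<omega>" if "0 \<le> s" for s
        using elim that by blast
    qed
  qed
qed

lemma X_moment:
  assumes p: "p \<ge> 1" and fin: "finite_moments M p N"
  shows "integrable M (\<lambda>\<omega>. \<bar>X t \<omega>\<bar> powr p)"
proof -
  let ?E = "\<lambda>Y. \<integral>\<^sup>+\<omega>. ennreal (\<bar>Y \<omega>\<bar> powr p) \<partial>M"
  obtain B where B: "B < \<top>" "\<And>s. s \<in> {0..1} \<Longrightarrow> ?E (N s) \<le> B"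
    using N_moment_locally_bounded[OF p fin] by blast
  let ?Z = "\<lambda>s \<omega>. exp (- lam * (1 - s)) * N s \<omega>"
  \<comment> \<open>The exponential weight is at most 1 for \<open>s\<close> in
    \<open>{0..1}\<close>.\<close>
  have "?E (?Z s) \<le> B" if "s \<in> {0..1}" for s
  proof -
    have "?E (?Z s) \<le> ?E (N s)"
      using that lam_pos p by (intro nn_integral_mono ennreal_leI powr_mono2) (auto simp: abs_mult mult_left_le_one_le)
    then show ?thesis using B(2)[OF that] by simp
  qed
  then have "?E (\<lambda>\<omega>. LINT s:{0..1}|lborel. ?Z s \<omega>) \<le> ennreal (1 powr p) * B"
    using p by (intro moment_integral_le) auto
  then have Z: "?E (\<lambda>\<omega>. LINT s:{0..1}|lborel. ?Z s \<omega>) < \<top>" using B(1) by simp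
  have I [measurable]: "(\<lambda>\<omega>. LINT s:{0..1}|lborel. ?Z s \<omega>) \<in> borel_measurable M"
    unfolding set_lebesgue_integral_def by measurable
  have "?E (\<lambda>\<omega>. X 1 \<omega> - exp (- lam) * X 0 \<omega>) = ?E (\<lambda>\<omega>. N 1 \<omega> + (- lam) * (LINT s:{0..1}|lborel. ?Z s \<omega>))"
  proof (rule nn_integral_cong_AE)
    show "AE \<omega> in M. ennreal (\<bar>X 1 \<omega> - exp (- lam) * X 0 \<omega>\<bar> powr p) =
        ennreal (\<bar>N 1 \<omega> + (- lam) * (LINT s:{0..1}|lborel. ?Z s \<omega>)\<bar> powr p)"
      using X_eq_X'
    proof eventually_elim
      case (elim \<omega>)
      have "X 1 \<omega> = X' 1 \<omega>" using elim by simp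
      then have "X 1 \<omega> - exp (- lam) * X 0 \<omega> = N 1 \<omega> + (- lam) * (LINT s:{0..1}|lborel. ?Z s \<omega>)"
        by (simp add: X'_def)
      then show ?case by simp
    qed
  qed
  also have "\<dots> \<le> ennreal (2 powr p) * (?E (N 1) + ?E (\<lambda>\<omega>. (- lam) * (LINT s:{0..1}|lborel. ?Z s \<omega>)))"
    by (intro nn_integral_abs_powr_add_le p) measurable
  also have "\<dots> < \<top>"
    using Z B(2)[of 1] B(1) unfolding nn_integral_abs_powr_cmult[OF I] by (auto simp: ennreal_mult_less_top)
  finally have "integrable M (\<lambda>\<omega>. \<bar>X 1 \<omega> - exp (- lam) * X 0 \<omega>\<bar> powr p)"
    by (simp add: nn_integral_abs_powr_finite_iff)
  \<comment> \<open>The recursion is applied with \<open>Y' = X 1\<close>, \<open>Y = X 0\<close>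
    and contraction factor \<open>exp (- lam)\<close>, which is below 1.\<close>
  then have "integrable M (\<lambda>\<omega>. \<bar>X 0 \<omega>\<bar> powr p)"
    using lam_pos by (intro integrable_of_affine_recursion[OF _ _ X_integral_eq _ _ p]) auto
  then show ?thesis
    using X_nn_integral_eq[of "\<lambda>x. ennreal (\<bar>x\<bar> powr p)" t]
    by (simp add: nn_integral_abs_powr_finite_iff)
qed

text \<open>By stationarity all \<open>X' s\<close> with \<open>s \<ge> 0\<close> have the
  \<open>p\<close>-th moment of \<open>X 0\<close>, which is therefore the uniform bound required by
  \<open>moment_integral_le\<close>.\<close>

lemma X_integral_moment_le:
  assumes p: "p \<ge> 1" and fin: "finite_moments M p N" and t: "t \<ge> 0"
  shows "integrable M (\<lambda>\<omega>. \<bar>LINT s:{0..t}|lborel. X' s \<omega>\<bar> powr p)"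
    and "Lp_norm M p (\<lambda>\<omega>. LINT s:{0..t}|lborel. X' s \<omega>) \<le> t * Lp_norm M p (X 0)"
proof -
  let ?E = "\<lambda>Y. \<integral>\<^sup>+\<omega>. ennreal (\<bar>Y \<omega>\<bar> powr p) \<partial>M"
  have "?E (X' s) = ?E (X 0)" if "s \<ge> 0" for s
  proof -
    have "?E (X' s) = ?E (X s)"
      using X_eq_X' that by (intro nn_integral_cong_AE) auto
    then show ?thesis using X_nn_integral_eq[of "\<lambda>x. ennreal (\<bar>x\<bar> powr p)" s] by simp
  qed
  then have "?E (\<lambda>\<omega>. LINT s:{0..t}|lborel. X' s \<omega>) \<le> ennreal (t powr p) * ?E (X 0)"
    using p t by (intro moment_integral_le) auto
  also have "?E (X 0) = ennreal (\<integral>\<omega>. \<bar>X 0 \<omega>\<bar> powr p \<partial>M)"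
    using X_moment[OF p fin, of 0] by (intro nn_integral_eq_integral) auto
  also have "ennreal (t powr p) * \<dots> = ennreal (t powr p * Lp_norm M p (X 0) powr p)"
    by (simp add: ennreal_mult' Lp_norm_powr[OF p])
  also have "\<dots> = ennreal ((t * Lp_norm M p (X 0)) powr p)"
    using t by (simp add: powr_mult Lp_norm_nonneg)
  finally have le: "?E (\<lambda>\<omega>. LINT s:{0..t}|lborel. X' s \<omega>) \<le> ennreal ((t * Lp_norm M p (X 0)) powr p)" .
  have [measurable]: "(\<lambda>\<omega>. LINT s:{0..t}|lborel. X' s \<omega>) \<in> borel_measurable M"
    unfolding set_lebesgue_integral_def by measurable
  show int: "integrable M (\<lambda>\<omega>. \<bar>LINT s:{0..t}|lborel. X' s \<omega>\<bar> powr p)"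
    using le by (subst nn_integral_abs_powr_finite_iff) (auto simp: le_less_trans)
  have "ennreal (\<integral>\<omega>. \<bar>LINT s:{0..t}|lborel. X' s \<omega>\<bar> powr p \<partial>M) \<le> ennreal ((t * Lp_norm M p (X 0)) powr p)"
    using le int by (subst nn_integral_eq_integral[symmetric]) auto
  then have "(\<integral>\<omega>. \<bar>LINT s:{0..t}|lborel. X' s \<omega>\<bar> powr p \<partial>M) \<le> (t * Lp_norm M p (X 0)) powr p"
    by (simp add: ennreal_le_iff)
  then show "Lp_norm M p (\<lambda>\<omega>. LINT s:{0..t}|lborel. X' s \<omega>) \<le> t * Lp_norm M p (X 0)"
    unfolding Lp_norm_def[of M p "\<lambda>\<omega>. LINT s:{0..t}|lborel. X' s \<omega>"]
    using p t by (intro powr_inverse_exponent_mono) (auto simp: Lp_norm_nonneg)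
qed

lemma AE_increment:
  assumes "t \<ge> 0"
  shows "AE \<omega> in M. X t \<omega> - X 0 \<omega> = N t \<omega> + (- lam) * (LINT s:{0..t}|lborel. X' s \<omega>)"
  using qou_path X_eq_X'
proof eventually_elim
  case (elim \<omega>)
  have "(LINT s:{0..t}|lborel. X s \<omega>) = (LINT s:{0..t}|lborel. X' s \<omega>)"
    using elim(2) by (intro set_lebesgue_integral_cong) auto
  moreover have "X t \<omega> = X 0 \<omega> - lam * (LINT s:{0..t}|lborel. X s \<omega>) + N t \<omega>"
    using elim(1) assms by blast
  ultimately show ?case by simp
qed

text \<open>For \<open>t \<ge> 0\<close> the increments of \<open>X\<close> and \<open>N\<close>
  differ by \<open>lam\<close> times the integral of \<open>X'\<close>, so the reverse triangle
  inequality applies. For \<open>t < 0\<close>, shifting by \<open>- t\<close> gives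
  \<open>X t - X 0\<close> the law of \<open>X 0 - X (- t)\<close>.\<close>

lemma Lp_norm_increment_bound:
  assumes p: "p \<ge> 1" and fin: "finite_moments M p N"
  shows "\<bar>Lp_norm M p (\<lambda>\<omega>. X t \<omega> - X 0 \<omega>) - Lp_norm M p (N t)\<bar> \<le> lam * Lp_norm M p (X 0) * \<bar>t\<bar>"
proof -
  have nonneg: "\<bar>Lp_norm M p (\<lambda>\<omega>. X t \<omega> - X 0 \<omega>) - Lp_norm M p (N t)\<bar> \<le> lam * Lp_norm M p (X 0) * t"
    if t: "t \<ge> 0" for t
  proof -
    let ?I = "\<lambda>\<omega>. LINT s:{0..t}|lborel. X' s \<omega>"
    have I [measurable]: "?I \<in> borel_measurable M"
      unfolding set_lebesgue_integral_def by measurable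
    have eq: "Lp_norm M p (\<lambda>\<omega>. X t \<omega> - X 0 \<omega>) = Lp_norm M p (\<lambda>\<omega>. N t \<omega> + (- lam) * ?I \<omega>)"
      unfolding Lp_norm_def
    proof (intro arg_cong[where f="\<lambda>x. x powr (1 / p)"] integral_cong_AE)
      show "AE \<omega> in M. \<bar>X t \<omega> - X 0 \<omega>\<bar> powr p = \<bar>N t \<omega> + (- lam) * ?I \<omega>\<bar> powr p"
        using AE_increment[OF t] by eventually_elim (simp only:)
    qed measurable
    have "\<bar>Lp_norm M p (\<lambda>\<omega>. X t \<omega> - X 0 \<omega>) - Lp_norm M p (N t)\<bar> \<le> Lp_norm M p (\<lambda>\<omega>. (- lam) * ?I \<omega>)"
      unfolding eq using fin X_integral_moment_le(1)[OF p fin t]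
      by (intro Lp_norm_diff_le p) (auto simp: finite_moments_def abs_mult powr_mult)
    also have "\<dots> = lam * Lp_norm M p ?I"
      using lam_pos p by (simp add: Lp_norm_def abs_mult powr_mult powr_powr)
    also have "\<dots> \<le> lam * (t * Lp_norm M p (X 0))"
      using lam_pos X_integral_moment_le(2)[OF p fin t] by (intro mult_left_mono) auto
    finally show ?thesis by (simp add: ac_simps)
  qed
  show ?thesis
  proof (cases "t \<ge> 0")
    case False
    have "Lp_norm M p (N t) = Lp_norm M p (N (- t))"
      using N_integral_minus[of "\<lambda>x. \<bar>x\<bar> powr p" t] by (simp add: Lp_norm_def)
    moreover have "Lp_norm M p (\<lambda>\<omega>. X t \<omega> - X 0 \<omega>) = Lp_norm M p (\<lambda>\<omega>. X (- t) \<omega> - X 0 \<omega>)"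
      using X_integral_shift[of "\<lambda>(x, y). \<bar>x - y\<bar> powr p" t "- t" 0]
      by (simp add: Lp_norm_def abs_minus_commute[of "X 0 _"])
    ultimately show ?thesis using nonneg[of "- t"] False by simp
  qed (use nonneg in simp)
qed

lemma Lp_norm_increment_asymp:
  assumes p: "p \<ge> 1" and fin: "finite_moments M p N"
    and o: "(\<lambda>t. t) \<in> o[at 0](\<lambda>t. Lp_norm M p (N t))"
  shows "(\<lambda>t. Lp_norm M p (\<lambda>\<omega>. X t \<omega> - X 0 \<omega>)) \<sim>[at 0] (\<lambda>t. Lp_norm M p (N t))"
proof (rule smallo_imp_asymp_equiv)
  have "(\<lambda>t. Lp_norm M p (\<lambda>\<omega>. X t \<omega> - X 0 \<omega>) - Lp_norm M p (N t)) \<in> O[at 0](\<lambda>t. t)"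
    using Lp_norm_increment_bound[OF p fin] by (intro bigoI[where c="lam * Lp_norm M p (X 0)"]) auto
  then show "(\<lambda>t. Lp_norm M p (\<lambda>\<omega>. X t \<omega> - X 0 \<omega>) - Lp_norm M p (N t)) \<in> o[at 0](\<lambda>t. Lp_norm M p (N t))"
    using o by (rule landau_o.big_small_trans)
qed

end

subsection \<open>Second-order structure\<close>

lemma abs_mult_le_sum_squares:
  fixes y z :: real
  shows "\<bar>y * z\<bar> \<le> y\<^sup>2 + z\<^sup>2"
proof -
  have "0 \<le> \<bar>y\<bar> * \<bar>z\<bar>" by simp
  then show ?thesis
    using sum_squares_bound[of "\<bar>y\<bar>" "\<bar>z\<bar>"] unfolding abs_mult power2_abs by linarith
qed

lemma integrable_mult_of_squares:
  fixes Y Z :: "'a \<Rightarrow> real"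
  assumes [measurable]: "Y \<in> borel_measurable M" "Z \<in> borel_measurable M"
    and "integrable M (\<lambda>\<omega>. (Y \<omega>)\<^sup>2)" "integrable M (\<lambda>\<omega>. (Z \<omega>)\<^sup>2)"
  shows "integrable M (\<lambda>\<omega>. Y \<omega> * Z \<omega>)"
proof (rule Bochner_Integration.integrable_bound)
  show "integrable M (\<lambda>\<omega>. (Y \<omega>)\<^sup>2 + (Z \<omega>)\<^sup>2)" using assms by simp
  show "AE \<omega> in M. norm (Y \<omega> * Z \<omega>) \<le> norm ((Y \<omega>)\<^sup>2 + (Z \<omega>)\<^sup>2)"
    by (simp add: abs_mult_le_sum_squares)
qed measurable

section \<open>Integrals of bounded and even functions over compact intervals\<close>

lemma set_integrable_bounded_Icc:
  fixes f :: "real \<Rightarrow> real"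
  assumes [measurable]: "f \<in> borel_measurable borel" and bd: "\<And>s. s \<in> {a..b} \<Longrightarrow> \<bar>f s\<bar> \<le> B"
  shows "set_integrable lborel {a..b} f"
  unfolding set_integrable_def
proof (rule Bochner_Integration.integrable_bound)
  show "integrable lborel (\<lambda>s. B * indicator {a..b} s)"
    by (intro integrable_mult_right integrable_real_indicator) (auto simp: emeasure_lborel_Icc_eq)
  have "\<bar>f s\<bar> \<le> \<bar>B\<bar>" if "s \<in> {a..b}" for s using bd[OF that] by simp
  then show "AE s in lborel. norm (indicat_real {a..b} s *\<^sub>R f s) \<le> norm (B * indicator {a..b} s)"
    by (intro AE_I2) (auto simp: indicator_def)
qed measurable

lemma abs_set_integral_Icc_le:
  fixes f :: "real \<Rightarrow> real"
  assumes [measurable]: "f \<in> borel_measurable borel" and bd: "\<And>s. s \<in> {0..t} \<Longrightarrow> \<bar>f s\<bar> \<le> B"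
    and t: "t \<ge> 0"
  shows "\<bar>LINT s:{0..t}|lborel. f s\<bar> \<le> B * t"
proof -
  have f: "set_integrable lborel {0..t} f"
    using bd by (intro set_integrable_bounded_Icc) auto
  have "\<bar>LINT s:{0..t}|lborel. f s\<bar> \<le> (LINT s:{0..t}|lborel. \<bar>f s\<bar>)"
    using set_integral_norm_bound[OF f] by simp
  also have "\<dots> \<le> (LINT s:{0..t}|lborel. B)"
    using bd f by (intro set_integral_mono set_integrable_abs) (auto intro!: set_integrable_bounded_Icc)
  also have "\<dots> = B * t"
    using t by (simp add: set_lebesgue_integral_def)
  finally show ?thesis .
qed

lemma set_integral_reflect_Icc:
  fixes f :: "real \<Rightarrow> real"
  shows "(LINT s:{0..t}|lborel. f (t - s)) = (LINT s:{0..t}|lborel. f s)"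
proof -
  have "(LINT s:{0..t}|lborel. f s) = (LINT s|lborel. indicator {0..t} (t + - 1 * s) * f (t + - 1 * s))"
    unfolding set_lebesgue_integral_def
    by (subst lborel_integral_real_affine[where c="- 1" and t=t]) auto
  also have "\<dots> = (LINT s:{0..t}|lborel. f (t - s))"
    unfolding set_lebesgue_integral_def by (intro Bochner_Integration.integral_cong) (auto simp: indicator_def)
  finally show ?thesis ..
qed

text \<open>Split at \<open>r = s\<close>: reflect the left piece, translate the right piece and use
  evenness. With the autocovariance as \<open>f\<close> this evaluates the inner integral in the
  variance of the integrated process.\<close>

lemma set_integral_even_split:
  fixes f :: "real \<Rightarrow> real"
  assumes [measurable]: "f \<in> borel_measurable borel" and bd: "\<And>s. \<bar>f s\<bar> \<le> B"
    and even: "\<And>s. f (- s) = f s" and s: "0 \<le> s" "s \<le> t"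
  shows "(LINT r:{0..t}|lborel. f (s - r)) = (LINT r:{0..s}|lborel. f r) + (LINT r:{0..t - s}|lborel. f r)"
proof -
  have int: "set_integrable lborel {a..b} (\<lambda>r. f (s - r))" for a b
    using bd by (intro set_integrable_bounded_Icc[where B=B]) auto
  have "(LINT r:{0..t}|lborel. f (s - r)) = (LINT r:{0..s} \<union> {s..t}|lborel. f (s - r))"
    using s by (simp add: ivl_disj_un_two_touch(4))
  also have "\<dots> = (LINT r:{0..s}|lborel. f (s - r)) + (LINT r:{s..t}|lborel. f (s - r))"
  proof (rule set_integral_Un_AE)
    show "AE x in lborel. \<not> (x \<in> {0..s} \<and> x \<in> {s..t})"
      by (intro AE_I'[of "{s}"]) auto
  qed (use int in auto)
  also have "(LINT r:{0..s}|lborel. f (s - r)) = (LINT r:{0..s}|lborel. f r)"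
    by (rule set_integral_reflect_Icc)
  also have "(LINT r:{s..t}|lborel. f (s - r)) = (LINT r|lborel. indicator {s..t} (s + 1 * r) * f (s - (s + 1 * r)))"
    unfolding set_lebesgue_integral_def
    by (subst lborel_integral_real_affine[where c=1 and t=s]) auto
  also have "\<dots> = (LINT r:{0..t - s}|lborel. f r)"
    unfolding set_lebesgue_integral_def
    by (intro Bochner_Integration.integral_cong) (auto simp: indicator_def even)
  finally show ?thesis .
qed

section \<open>The autocovariance function and the integrated centred process\<close>

locale qou_square_integrable = qou +
  assumes N_square: "finite_moments M 2 N"
begin

lemma X_square_integrable: "integrable M (\<lambda>\<omega>. (X t \<omega>)\<^sup>2)"
  using X_moment[OF _ N_square, of t] by simp

lemma X_integrable: "integrable M (X t)"
  using X_square_integrable by (rule square_integrable_imp_integrable[rotated]) simp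

definition mean :: real where "mean = expectation (X 0)"

lemma expectation_X: "expectation (X t) = mean"
  using X_integral_eq[of "\<lambda>x. x" t] by (simp add: mean_def)

lemma covariance_X: "(\<integral>\<omega>. (X s \<omega> - mean) * (X t \<omega> - mean) \<partial>M) = autocov M X (s - t)"
  using X_integral_shift[of "\<lambda>z. (fst z - mean) * (snd z - mean)" "s - t" t 0]
  by (simp add: autocov_def covar_def expectation_X)

lemma autocov_even: "autocov M X (- t) = autocov M X t"
  using covariance_X[of 0 t] covariance_X[of t 0] by (simp add: mult.commute)

lemma X_centered_square_integrable: "integrable M (\<lambda>\<omega>. (X t \<omega> - mean)\<^sup>2)"
  using X_square_integrable[of t] X_integrable[of t] by (simp add: power2_diff)

text \<open>Half the sum of squares bounds the product, and both squares have expectation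
  \<open>autocov M X 0\<close> by stationarity.\<close>

lemma autocov_bounded: "\<bar>autocov M X t\<bar> \<le> autocov M X 0"
proof -
  have sq: "(\<integral>\<omega>. (X s \<omega> - mean)\<^sup>2 \<partial>M) = autocov M X 0" for s
    using covariance_X[of s s] by (simp add: power2_eq_square)
  have "\<bar>autocov M X t\<bar> \<le> (\<integral>\<omega>. \<bar>(X t \<omega> - mean) * (X 0 \<omega> - mean)\<bar> \<partial>M)"
    unfolding covariance_X[of t 0, simplified, symmetric] by (rule integral_abs_bound)
  also have "\<dots> \<le> (\<integral>\<omega>. (X t \<omega> - mean)\<^sup>2 / 2 + (X 0 \<omega> - mean)\<^sup>2 / 2 \<partial>M)"
  proof (rule integral_mono)
    show "integrable M (\<lambda>\<omega>. \<bar>(X t \<omega> - mean) * (X 0 \<omega> - mean)\<bar>)"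
      by (intro integrable_abs integrable_mult_of_squares X_centered_square_integrable) measurable
    show "integrable M (\<lambda>\<omega>. (X t \<omega> - mean)\<^sup>2 / 2 + (X 0 \<omega> - mean)\<^sup>2 / 2)"
      using X_centered_square_integrable by simp
    show "\<bar>(X t \<omega> - mean) * (X 0 \<omega> - mean)\<bar> \<le> (X t \<omega> - mean)\<^sup>2 / 2 + (X 0 \<omega> - mean)\<^sup>2 / 2" for \<omega>
      using sum_squares_bound[of "\<bar>X t \<omega> - mean\<bar>" "\<bar>X 0 \<omega> - mean\<bar>"] by (simp add: abs_mult)
  qed
  also have "\<dots> = autocov M X 0"
    using X_centered_square_integrable by (simp add: sq)
  finally show ?thesis .
qed

text \<open>A jointly measurable version of the centred process on \<open>t \<ge> 0\<close>, to
  which Fubini can be applied.\<close>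

definition Y :: "real \<Rightarrow> 'a \<Rightarrow> real" where "Y t \<omega> = X' t \<omega> - mean"

lemma Y_joint [measurable]: "case_prod Y \<in> borel_measurable (borel \<Otimes>\<^sub>M M)"
  unfolding Y_def by measurable

lemma AE_Y: "t \<ge> 0 \<Longrightarrow> AE \<omega> in M. X t \<omega> - mean = Y t \<omega>"
  using X_eq_X' unfolding Y_def by eventually_elim auto

lemma covariance_Y:
  assumes "s \<ge> 0" "t \<ge> 0"
  shows "(\<integral>\<omega>. Y s \<omega> * Y t \<omega> \<partial>M) = autocov M X (s - t)"
proof -
  have "(\<integral>\<omega>. Y s \<omega> * Y t \<omega> \<partial>M) = (\<integral>\<omega>. (X s \<omega> - mean) * (X t \<omega> - mean) \<partial>M)"
  proof (rule integral_cong_AE)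
    show "AE \<omega> in M. Y s \<omega> * Y t \<omega> = (X s \<omega> - mean) * (X t \<omega> - mean)"
      using AE_Y[OF assms(1)] AE_Y[OF assms(2)] by eventually_elim simp
  qed measurable
  then show ?thesis by (simp add: covariance_X)
qed

lemma Y_square_integrable:
  assumes "t \<ge> 0"
  shows "integrable M (\<lambda>\<omega>. (Y t \<omega>)\<^sup>2)"
proof (rule integrable_cong_AE_imp[OF X_centered_square_integrable[of t]])
  show "AE \<omega> in M. (X t \<omega> - mean)\<^sup>2 = (Y t \<omega>)\<^sup>2"
    using AE_Y[OF assms] by eventually_elim simp
qed measurable

lemma expectation_Y:
  assumes t: "t \<ge> 0"
  shows "expectation (Y t) = 0"
proof -
  have "expectation (Y t) = (\<integral>\<omega>. X t \<omega> - mean \<partial>M)"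
  proof (rule integral_cong_AE)
    show "AE \<omega> in M. Y t \<omega> = X t \<omega> - mean"
      using AE_Y[OF t] by eventually_elim simp
  qed measurable
  then show ?thesis using X_integrable[of t] by (simp add: expectation_X prob_space)
qed

text \<open>Evenness allows \<open>|t|\<close> in place of \<open>t\<close>, so only times at which
  \<open>Y\<close> is a version of the centred process occur; joint measurability then passes to the
  expectation.\<close>

lemma autocov_measurable [measurable]: "autocov M X \<in> borel_measurable borel"
proof -
  have "autocov M X = (\<lambda>t. \<integral>\<omega>. Y \<bar>t\<bar> \<omega> * Y 0 \<omega> \<partial>M)"
  proof
    fix t
    show "autocov M X t = (\<integral>\<omega>. Y \<bar>t\<bar> \<omega> * Y 0 \<omega> \<partial>M)"
      using covariance_Y[of "\<bar>t\<bar>" 0] autocov_even[of t] by (cases "t \<ge> 0") auto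
  qed
  moreover have "case_prod (\<lambda>t \<omega>. Y \<bar>t\<bar> \<omega> * Y 0 \<omega>) \<in> borel_measurable (borel \<Otimes>\<^sub>M M)"
    unfolding case_prod_beta
    using measurable_compose[OF _ Y_joint, of "\<lambda>z. (\<bar>fst z\<bar>, snd z)" "borel \<Otimes>\<^sub>M M"] by simp
  ultimately show ?thesis by (simp add: borel_measurable_lebesgue_integral)
qed

lemma autocov_set_integrable: "set_integrable lborel {a..b} (autocov M X)"
  using autocov_bounded by (intro set_integrable_bounded_Icc) auto

definition I :: "real \<Rightarrow> 'a \<Rightarrow> real" where "I t \<omega> = (LINT s:{0..t}|lborel. Y s \<omega>)"

lemma I_rv [measurable]: "I t \<in> borel_measurable M"
  unfolding I_def set_lebesgue_integral_def by measurable

lemma I_square_integrable: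
  assumes t: "t \<ge> 0"
  shows "integrable M (\<lambda>\<omega>. (I t \<omega>)\<^sup>2)"
proof -
  have "(\<integral>\<^sup>+\<omega>. ennreal (\<bar>Y s \<omega>\<bar> powr 2) \<partial>M) \<le> ennreal (autocov M X 0)" if "s \<in> {0..t}" for s
    using Y_square_integrable[of s] covariance_Y[of s s] that
    by (simp add: nn_integral_eq_integral power2_eq_square)
  then have "(\<integral>\<^sup>+\<omega>. ennreal (\<bar>I t \<omega>\<bar> powr 2) \<partial>M) \<le> ennreal (t powr 2) * ennreal (autocov M X 0)"
    unfolding I_def using t by (intro moment_integral_le) auto
  also have "\<dots> < \<top>" by (simp add: ennreal_mult_less_top)
  finally show ?thesis
    using nn_integral_abs_powr_finite_iff[of "I t" M 2] by simp
qed

text \<open>Fubini for \<open>Z\<close> against the integral of \<open>Y\<close>. It is used with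
  \<open>Z\<close> constant, a value of \<open>Y\<close>, or \<open>I t\<close> itself, giving the
  mean, the cross covariances and the variance of \<open>I t\<close>.\<close>

lemma expectation_mult_I:
  assumes [measurable]: "Z \<in> borel_measurable M" and Z: "integrable M (\<lambda>\<omega>. (Z \<omega>)\<^sup>2)"
    and t: "t \<ge> 0"
  shows "(\<integral>\<omega>. Z \<omega> * I t \<omega> \<partial>M) = (LINT s:{0..t}|lborel. (\<integral>\<omega>. Z \<omega> * Y s \<omega> \<partial>M))"
proof -
  define f where "f s \<omega> = indicator {0..t} s * (Z \<omega> * Y s \<omega>)" for s \<omega>
  have fm [measurable]: "case_prod f \<in> borel_measurable (borel \<Otimes>\<^sub>M M)"
    unfolding f_def case_prod_beta
    by (intro borel_measurable_times measurable_compose[OF measurable_fst]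
        measurable_compose[OF measurable_snd] Y_joint[unfolded case_prod_beta]) auto
  have ZY: "integrable M (\<lambda>\<omega>. Z \<omega> * Y s \<omega>)" if "s \<ge> 0" for s
    using Z Y_square_integrable[OF that] by (intro integrable_mult_of_squares) auto
  have inner: "integrable M (f s)" for s
    using ZY[of s] by (cases "s \<in> {0..t}") (auto simp: f_def[abs_def])
  \<comment> \<open>Bounds the expectation of \<open>|Z * Y s|\<close> uniformly in
    \<open>s\<close>, since the second moment of \<open>Y s\<close> is
    \<open>autocov M X 0\<close>.\<close>
  define B where "B = (\<integral>\<omega>. (Z \<omega>)\<^sup>2 \<partial>M) + autocov M X 0"
  have "(\<integral>\<omega>. norm (f s \<omega>) \<partial>M) \<le> B * indicator {0..t} s" for s
  proof (cases "s \<in> {0..t}")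
    case True
    have "(\<integral>\<omega>. norm (f s \<omega>) \<partial>M) \<le> (\<integral>\<omega>. (Z \<omega>)\<^sup>2 + (Y s \<omega>)\<^sup>2 \<partial>M)"
    proof (rule integral_mono)
      show "integrable M (\<lambda>\<omega>. norm (f s \<omega>))" using inner by (rule integrable_norm)
      show "integrable M (\<lambda>\<omega>. (Z \<omega>)\<^sup>2 + (Y s \<omega>)\<^sup>2)" using Z Y_square_integrable[of s] True by simp
      show "norm (f s \<omega>) \<le> (Z \<omega>)\<^sup>2 + (Y s \<omega>)\<^sup>2" for \<omega>
        using True by (simp add: f_def abs_mult_le_sum_squares)
    qed
    also have "\<dots> = B"
      using Z Y_square_integrable[of s] covariance_Y[of s s] True by (simp add: B_def power2_eq_square)
    finally show ?thesis using True by simp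
  qed (simp add: f_def)
  then have bound: "(\<integral>\<omega>. norm (case_prod f (s, \<omega>)) \<partial>M) \<le> B * indicator {0..t} s" for s by simp
  have f: "integrable (lborel \<Otimes>\<^sub>M M) (case_prod f)"
  proof (rule L.Fubini_integrable)
    show "case_prod f \<in> borel_measurable (lborel \<Otimes>\<^sub>M M)" by measurable
    show "integrable lborel (\<lambda>s. \<integral>\<omega>. norm (case_prod f (s, \<omega>)) \<partial>M)"
    proof (rule Bochner_Integration.integrable_bound)
      show "integrable lborel (\<lambda>s. B * indicator {0..t} s)"
        by (intro integrable_mult_right integrable_real_indicator) (auto simp: emeasure_lborel_Icc_eq)
      show "(\<lambda>s. \<integral>\<omega>. norm (case_prod f (s, \<omega>)) \<partial>M) \<in> borel_measurable lborel"
        by (intro borel_measurable_lebesgue_integral) (use fm in simp)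
      show "AE s in lborel. norm (\<integral>\<omega>. norm (case_prod f (s, \<omega>)) \<partial>M) \<le> norm (B * indicator {0..t} s)"
        by (intro AE_I2 order_trans[OF _ abs_ge_self[of "B * indicator {0..t} _", folded real_norm_def]])
          (use bound in \<open>simp add: integral_nonneg_AE\<close>)
    qed
    show "AE s in lborel. integrable M (\<lambda>\<omega>. case_prod f (s, \<omega>))" using inner by simp
  qed
  have "(\<integral>\<omega>. Z \<omega> * I t \<omega> \<partial>M) = (\<integral>\<omega>. (LINT s|lborel. f s \<omega>) \<partial>M)"
    unfolding f_def I_def set_lebesgue_integral_def
    by (intro Bochner_Integration.integral_cong refl) (simp add: mult.left_commute flip: integral_mult_right_zero)
  also have "\<dots> = (LINT s|lborel. \<integral>\<omega>. f s \<omega> \<partial>M)"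
    using L.integral_fst[OF f] L.integral_snd[OF f] by simp
  also have "\<dots> = (LINT s:{0..t}|lborel. (\<integral>\<omega>. Z \<omega> * Y s \<omega> \<partial>M))"
    by (simp add: f_def set_lebesgue_integral_def)
  finally show ?thesis .
qed

text \<open>Solving the equation for \<open>N\<close> isolates the deterministic drift
  \<open>lam * mean * t\<close>, which does not contribute to the variance.\<close>

lemma AE_N_eq:
  assumes t: "t \<ge> 0"
  shows "AE \<omega> in M. N t \<omega> = (Y t \<omega> - Y 0 \<omega> + lam * I t \<omega>) + lam * mean * t"
  using AE_increment[OF t] AE_Y[OF t] AE_Y[of 0, simplified] qou_path X_eq_X'
proof eventually_elim
  case (elim \<omega>)
  have "set_integrable lborel {0..t} (\<lambda>s. X s \<omega>)" using elim(4) t by blast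
  also have "?this \<longleftrightarrow> set_integrable lborel {0..t} (\<lambda>s. X' s \<omega>)"
    using elim(5) by (intro set_integrable_cong) auto
  finally have "I t \<omega> = (LINT s:{0..t}|lborel. X' s \<omega>) - (LINT s:{0..t}|lborel. mean)"
    unfolding I_def Y_def by (intro set_integral_diff) (auto intro!: set_integrable_bounded_Icc)
  also have "(LINT s:{0..t}|lborel. mean) = mean * t"
    using t by (simp add: set_lebesgue_integral_def)
  finally have "(LINT s:{0..t}|lborel. X' s \<omega>) = I t \<omega> + mean * t" by simp
  then show ?case using elim(1-3) by (simp add: algebra_simps)
qed

text \<open>The inner integral in the variance identity: twice the integral of \<open>G\<close> over
  \<open>{0..t}\<close> is the variance of \<open>I t\<close>.\<close>

definition G :: "real \<Rightarrow> real" where "G s = (LINT r:{0..s}|lborel. autocov M X r)"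

lemma G_bound: "s \<ge> 0 \<Longrightarrow> \<bar>G s\<bar> \<le> autocov M X 0 * s"
  unfolding G_def using autocov_bounded by (intro abs_set_integral_Icc_le) auto

lemma G_measurable [measurable]: "G \<in> borel_measurable borel"
proof -
  have *: "G s = (LINT r|lborel. (if 0 \<le> r \<and> r \<le> s then autocov M X r else 0))" for s
    unfolding G_def set_lebesgue_integral_def by (intro Bochner_Integration.integral_cong) auto
  show ?thesis
    unfolding *[abs_def] by measurable
qed

text \<open>The covariances of \<open>I t\<close> with \<open>Y t\<close> and with \<open>Y 0\<close> agree, so the cross terms cancel.\<close>

lemma var_fun_N:
  assumes t: "t \<ge> 0"
  shows "var_fun M N t = 2 * (autocov M X 0 - autocov M X t) + 2 * lam\<^sup>2 * (LINT s:{0..t}|lborel. G s)"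
proof -
  let ?R = "autocov M X"
  have Y_int: "integrable M (Y s)" if "s \<ge> 0" for s
    using Y_square_integrable[OF that] by (rule square_integrable_imp_integrable[rotated]) simp
  have I_int: "integrable M (I t)"
    using I_square_integrable[OF t] by (rule square_integrable_imp_integrable[rotated]) simp
  have EI: "expectation (I t) = 0"
  proof -
    have "expectation (I t) = (LINT s:{0..t}|lborel. expectation (Y s))"
      using expectation_mult_I[of "\<lambda>_. 1" t] t by simp
    also have "\<dots> = (LINT s:{0..t}|lborel. 0)"
      by (intro set_lebesgue_integral_cong) (auto simp: expectation_Y)
    finally show ?thesis by (simp add: set_lebesgue_integral_def)
  qed
  have EN: "expectation (N t) = lam * mean * t"
  proof -
    have "expectation (N t) = (\<integral>\<omega>. (Y t \<omega> - Y 0 \<omega> + lam * I t \<omega>) + lam * mean * t \<partial>M)"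
      using AE_N_eq[OF t] by (intro integral_cong_AE) auto
    also have "\<dots> = lam * mean * t"
      using Y_int[of t] Y_int[of 0] I_int t EI expectation_Y[of t] expectation_Y[of 0] by (simp add: prob_space)
    finally show ?thesis .
  qed
  have YI: "integrable M (\<lambda>\<omega>. Y s \<omega> * I t \<omega>)" if "s \<ge> 0" for s
    using Y_square_integrable[OF that] I_square_integrable[OF t] by (intro integrable_mult_of_squares) auto
  have YY: "integrable M (\<lambda>\<omega>. Y s \<omega> * Y r \<omega>)" if "s \<ge> 0" "r \<ge> 0" for s r
    using Y_square_integrable[OF that(1)] Y_square_integrable[OF that(2)] by (intro integrable_mult_of_squares) auto
  have II: "integrable M (\<lambda>\<omega>. I t \<omega> * I t \<omega>)"
    using I_square_integrable[OF t] by (simp add: power2_eq_square)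
  have EYI: "(\<integral>\<omega>. Y s \<omega> * I t \<omega> \<partial>M) = (LINT r:{0..t}|lborel. ?R (s - r))" if "s \<ge> 0" for s
    using expectation_mult_I[OF _ Y_square_integrable[OF that] t] that
    by (auto simp: covariance_Y intro!: set_lebesgue_integral_cong)
  \<comment> \<open>The two sides are the integrals over \<open>{0..t}\<close> of the autocovariance
    at \<open>t - r\<close> and at \<open>- r\<close>; evenness and the reflection of the interval
    identify them.\<close>
  have EYI_t: "(\<integral>\<omega>. Y t \<omega> * I t \<omega> \<partial>M) = (\<integral>\<omega>. Y 0 \<omega> * I t \<omega> \<partial>M)"
    using t by (simp add: EYI autocov_even set_integral_reflect_Icc)
  have "\<bar>G s\<bar> \<le> ?R 0 * t" if "s \<in> {0..t}" for s
    using G_bound[of s] that autocov_bounded[of 0] mult_left_mono[of s t "?R 0"] by simp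
  then have G_int: "set_integrable lborel {0..t} G" "set_integrable lborel {0..t} (\<lambda>s. G (t - s))"
    by (auto intro!: set_integrable_bounded_Icc[where B="?R 0 * t"])
  \<comment> \<open>The second moment is the integral of the autocovariance at \<open>s - r\<close>
    over the square. The integral over \<open>r\<close> is \<open>G s + G (t - s)\<close>, and both
    summands contribute equally by reflection.\<close>
  have EII: "(\<integral>\<omega>. I t \<omega> * I t \<omega> \<partial>M) = 2 * (LINT s:{0..t}|lborel. G s)"
  proof -
    have "(\<integral>\<omega>. I t \<omega> * I t \<omega> \<partial>M) = (LINT s:{0..t}|lborel. (\<integral>\<omega>. Y s \<omega> * I t \<omega> \<partial>M))"
      using expectation_mult_I[OF _ I_square_integrable[OF t] t] by (simp add: mult.commute)
    also have "\<dots> = (LINT s:{0..t}|lborel. G s + G (t - s))"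
      using autocov_bounded
      by (intro set_lebesgue_integral_cong)
        (auto simp: EYI G_def intro!: set_integral_even_split[where B="?R 0"] autocov_even)
    also have "\<dots> = (LINT s:{0..t}|lborel. G s) + (LINT s:{0..t}|lborel. G (t - s))"
      using G_int by (rule set_integral_add)
    finally show ?thesis by (simp add: set_integral_reflect_Icc)
  qed
  have "var_fun M N t = (\<integral>\<omega>. (Y t \<omega> - Y 0 \<omega> + lam * I t \<omega>)\<^sup>2 \<partial>M)"
    unfolding var_fun_def EN using AE_N_eq[OF t] by (intro integral_cong_AE) auto
  also have "\<dots> = (\<integral>\<omega>. Y t \<omega> * Y t \<omega> + Y 0 \<omega> * Y 0 \<omega> - 2 * (Y t \<omega> * Y 0 \<omega>)
      + 2 * lam * (Y t \<omega> * I t \<omega>) - 2 * lam * (Y 0 \<omega> * I t \<omega>) + lam\<^sup>2 * (I t \<omega> * I t \<omega>) \<partial>M)"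
    by (intro Bochner_Integration.integral_cong refl) (simp add: power2_eq_square algebra_simps)
  also have "\<dots> = ?R 0 + ?R 0 - 2 * ?R t + lam\<^sup>2 * (2 * (LINT s:{0..t}|lborel. G s))"
    using t by (simp add: YY YI II covariance_Y EYI_t EII)
  finally show ?thesis by (simp add: algebra_simps)
qed

lemma var_fun_N_even: "var_fun M N (- t) = var_fun M N t"
proof -
  have E: "expectation (N (- t)) = - expectation (N t)"
    using N_integral_minus[of "\<lambda>x. x" t] by simp
  have "var_fun M N (- t) = (\<integral>\<omega>. (- N t \<omega> + expectation (N t))\<^sup>2 \<partial>M)"
    using N_integral_minus[of "\<lambda>x. (x + expectation (N t))\<^sup>2" t] by (simp add: var_fun_def E)
  also have "\<dots> = var_fun M N t"
    unfolding var_fun_def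
    by (intro Bochner_Integration.integral_cong refl) (simp add: power2_eq_square algebra_simps)
  finally show ?thesis .
qed

text \<open>By the variance identity the difference is \<open>lam\<^sup>2\<close> times the integral
  of \<open>G\<close>, and \<open>|G s|\<close> is at most \<open>autocov M X 0 * t\<close> on
  \<open>{0..t}\<close>. Negative times follow since both functions are even.\<close>

lemma compl_autocov_bound: "\<bar>compl_autocov M X t - 1 / 2 * var_fun M N t\<bar> \<le> lam\<^sup>2 * autocov M X 0 * t\<^sup>2"
proof -
  have nonneg: "\<bar>compl_autocov M X t - 1 / 2 * var_fun M N t\<bar> \<le> lam\<^sup>2 * autocov M X 0 * t\<^sup>2"
    if t: "t \<ge> 0" for t
  proof -
    have "compl_autocov M X t - 1 / 2 * var_fun M N t = - (lam\<^sup>2 * (LINT s:{0..t}|lborel. G s))"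
      by (simp add: compl_autocov_def var_fun_N[OF t] field_simps)
    also have "\<bar>\<dots>\<bar> = lam\<^sup>2 * \<bar>LINT s:{0..t}|lborel. G s\<bar>"
      by (simp add: abs_mult)
    also have "\<dots> \<le> lam\<^sup>2 * ((autocov M X 0 * t) * t)"
    proof (intro mult_left_mono abs_set_integral_Icc_le t)
      fix s assume "s \<in> {0..t}"
      then show "\<bar>G s\<bar> \<le> autocov M X 0 * t"
        using G_bound[of s] autocov_bounded[of 0] mult_left_mono[of s t "autocov M X 0"] by simp
    qed auto
    finally show ?thesis by (simp add: power2_eq_square ac_simps)
  qed
  show ?thesis
    using nonneg[of t] nonneg[of "- t"]
    by (cases "t \<ge> 0") (auto simp: var_fun_N_even compl_autocov_def autocov_even)
qed

lemma compl_autocov_asymp: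
  assumes o: "(\<lambda>t. t\<^sup>2) \<in> o[at 0](var_fun M N)"
  shows "compl_autocov M X \<sim>[at 0] (\<lambda>t. 1 / 2 * var_fun M N t)"
proof (rule smallo_imp_asymp_equiv)
  have "(\<lambda>t. compl_autocov M X t - 1 / 2 * var_fun M N t) \<in> O[at 0](\<lambda>t. t\<^sup>2)"
    using compl_autocov_bound by (intro bigoI[where c="lam\<^sup>2 * autocov M X 0"]) auto
  then have "(\<lambda>t. compl_autocov M X t - 1 / 2 * var_fun M N t) \<in> o[at 0](var_fun M N)"
    using o by (rule landau_o.big_small_trans)
  then show "(\<lambda>t. compl_autocov M X t - 1 / 2 * var_fun M N t) \<in> o[at 0](\<lambda>t. 1 / 2 * var_fun M N t)"
    by simp
qed

section \<open>Differentiating the variance identity\<close>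

lemma has_derivative_integral_G:
  assumes t: "t > 0"
  shows "((\<lambda>u. LINT s:{0..u}|lborel. G s) has_real_derivative G t) (at t)"
proof -
  have G_eq: "G = (\<lambda>s. integral {0..s} (autocov M X))"
    unfolding G_def using set_borel_integral_eq_integral(2)[OF autocov_set_integrable] by auto
  have cont: "continuous_on {0..t + 1} G"
    unfolding G_eq
    by (intro indefinite_integral_continuous_1 set_borel_integral_eq_integral(1) autocov_set_integrable)
  have G_int: "set_integrable lborel {0..u} G" for u
    using G_bound autocov_bounded[of 0]
    by (intro set_integrable_bounded_Icc[where B="autocov M X 0 * u"])
      (auto intro: order_trans[OF G_bound] mult_left_mono)
  have "((\<lambda>u. integral {0..u} G) has_real_derivative G t) (at t within {0..t + 1})"
    using t by (intro integral_has_real_derivative cont) auto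
  then have "((\<lambda>u. integral {0..u} G) has_real_derivative G t) (at t)"
    using t by (simp add: at_within_Icc_at[of 0 t "t + 1"])
  then show ?thesis
    using set_borel_integral_eq_integral(2)[OF G_int] by simp
qed

lemma has_derivative_G:
  assumes t: "t > 0" and cont: "isCont (autocov M X) t"
  shows "(G has_real_derivative autocov M X t) (at t)"
proof -
  have G_eq: "G = (\<lambda>s. integral {0..s} (autocov M X))"
    unfolding G_def using set_borel_integral_eq_integral(2)[OF autocov_set_integrable] by auto
  have "((\<lambda>u. integral {0..u} (autocov M X)) has_vector_derivative autocov M X t) (at t within ({0..t + 1} - {}))"
    using t continuous_at_imp_continuous_at_within[OF cont]
    by (intro integral_has_vector_derivative_continuous_at set_borel_integral_eq_integral(1)
        autocov_set_integrable) auto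
  then show ?thesis
    using t unfolding G_eq has_real_derivative_iff_has_vector_derivative
    by (simp add: at_within_Icc_at[of 0 t "t + 1"])
qed

text \<open>A bootstrap: the variance identity expresses the autocovariance by
  \<open>var_fun M N\<close> and the integral of \<open>G\<close>, so it is differentiable. Being
  then continuous, it makes \<open>G\<close> differentiable, which yields the second-order equation
  for \<open>bounded_solution_asymp\<close>.\<close>

lemma autocov_asymp:
  assumes C: "C_near_infinity 3 (var_fun M N)"
    and O: "(deriv ^^ 2) (var_fun M N) \<in> O[at_top](\<lambda>t. exp (lam / 2 * t))"
    and o: "(\<lambda>t. exp (- lam * t)) \<in> o[at_top]((deriv ^^ 2) (var_fun M N))"
    and o': "(deriv ^^ 3) (var_fun M N) \<in> o[at_top]((deriv ^^ 2) (var_fun M N))"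
  shows "autocov M X \<sim>[at_top] (\<lambda>t. 1 / (2 * lam\<^sup>2) * (deriv ^^ 2) (var_fun M N) t)"
proof -
  let ?V = "var_fun M N" and ?R = "autocov M X"
  obtain T where T: "\<And>k t. k < 3 \<Longrightarrow> t > T \<Longrightarrow> (deriv ^^ k) ?V differentiable (at t)"
    using C unfolding C_near_infinity_def by blast
  have D: "((deriv ^^ k) ?V has_real_derivative (deriv ^^ Suc k) ?V t) (at t)" if "k < 3" "t > T" for k t
    using T[OF that] by (simp add: DERIV_deriv_iff_real_differentiable)
  have DR: "(?R has_real_derivative (- deriv ?V t / 2 + lam\<^sup>2 * G t)) (at t)" if t: "t > T" "t > 0" for t
  proof -
    have "((\<lambda>t. ?R 0 - ?V t / 2 + lam\<^sup>2 * (LINT s:{0..t}|lborel. G s)) has_real_derivative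
        (- deriv ?V t / 2 + lam\<^sup>2 * G t)) (at t)"
      using D[of 0 t] t has_derivative_integral_G[OF t(2)]
      by (auto intro!: derivative_eq_intros)
    \<comment> \<open>The identity is available on the open half-line of positive times, which is a
      neighbourhood of \<open>t\<close> and so transfers the derivative.\<close>
    moreover have "eventually (\<lambda>t. ?R 0 - ?V t / 2 + lam\<^sup>2 * (LINT s:{0..t}|lborel. G s) = ?R t) (nhds t)"
      using eventually_nhds_in_open[of "{0<..}" t] t
      by (auto elim!: eventually_mono simp: var_fun_N field_simps)
    ultimately show ?thesis
      by (rule DERIV_cong_ev[OF refl _ refl, THEN iffD1, rotated])
  qed
  have DR': "((\<lambda>t. - deriv ?V t / 2 + lam\<^sup>2 * G t) has_real_derivative
      lam\<^sup>2 * ?R t - (deriv ^^ 2) ?V t / 2) (at t)" if t: "t > T" "t > 0" for t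
    using D[of 1 t] t has_derivative_G[OF t(2) DERIV_isCont[OF DR[OF t]]]
    by (auto intro!: derivative_eq_intros simp: numeral_2_eq_2)
  \<comment> \<open>Positivity is imposed separately because \<open>T\<close> may be
    negative.\<close>
  have ev: "eventually (\<lambda>t. t > T \<and> t > 0) at_top"
    by (intro eventually_conj eventually_gt_at_top)
  show ?thesis
  proof (rule bounded_solution_asymp[OF lam_pos _ _ _ _ O o o'])
    show "eventually (\<lambda>t. (?R has_real_derivative (- deriv ?V t / 2 + lam\<^sup>2 * G t)) (at t)) at_top"
      using ev by eventually_elim (use DR in blast)
    show "eventually (\<lambda>t. ((\<lambda>t. - deriv ?V t / 2 + lam\<^sup>2 * G t) has_real_derivative
        lam\<^sup>2 * ?R t - (deriv ^^ 2) ?V t / 2) (at t)) at_top"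
      using ev by eventually_elim (use DR' in blast)
    show "eventually (\<lambda>t. ((deriv ^^ 2) ?V has_real_derivative (deriv ^^ 3) ?V t) (at t)) at_top"
      using ev D[of 2] by (auto elim!: eventually_mono simp: numeral_3_eq_3)
    show "eventually (\<lambda>t. \<bar>?R t\<bar> \<le> ?R 0) at_top"
      using autocov_bounded by simp
  qed
qed

end

theorem proposition2p5:
  fixes M :: "'a measure" and N X :: "real \<Rightarrow> 'a \<Rightarrow> real" and lam :: real
  assumes "prob_space M"
    and "measurable_process M N"
    and "stationary_increments M N"
    and "AE \<omega> in M. N 0 \<omega> = 0"
    and "finite_moments M 2 N"
    and "lam > 0"
    and "QOU_process M lam N X"
  shows
    "(C_near_infinity 3 (var_fun M N) \<and>
      (deriv ^^ 2) (var_fun M N) \<in> O[at_top](\<lambda>t. exp (lam / 2 * t)) \<and>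
      (\<lambda>t. exp (- lam * t)) \<in> o[at_top]((deriv ^^ 2) (var_fun M N)) \<and>
      (deriv ^^ 3) (var_fun M N) \<in> o[at_top]((deriv ^^ 2) (var_fun M N))
      \<longrightarrow> autocov M X \<sim>[at_top] (\<lambda>t. 1 / (2 * lam\<^sup>2) * (deriv ^^ 2) (var_fun M N) t))
     \<and>
     ((\<lambda>t. t\<^sup>2) \<in> o[at 0](var_fun M N)
      \<longrightarrow> compl_autocov M X \<sim>[at 0] (\<lambda>t. 1 / 2 * var_fun M N t))
     \<and>
     (\<forall>p::real. p \<ge> 1 \<and> finite_moments M p N \<and>
        (\<lambda>t. t) \<in> o[at 0](\<lambda>t. Lp_norm M p (N t))
      \<longrightarrow> (\<lambda>t. Lp_norm M p (\<lambda>\<omega>. X t \<omega> - X 0 \<omega>)) \<sim>[at 0] (\<lambda>t. Lp_norm M p (N t)))"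
proof -
  interpret prob_space M by fact
  interpret qou_square_integrable M N X lam
    by unfold_locales fact+
  show ?thesis
    using autocov_asymp compl_autocov_asymp Lp_norm_increment_asymp by blast
qed

end
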